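(* Let $k\ge 2$ be a natural number and let $\varepsilon>0$. Let $M$ be an integer, $N$ a natural number, $Q\ge 1$, and let $(a_n)_{M<n\le M+N}$ be arbitrary complex numbers. Put $Z:=\sum_{n=M+1}^{M+N}|a_n|^2$ and $e(x):=e^{2\pi i x}$. Then $$\sum_{q\le Q}\ \sum_{\substack{a=1\\(a,q)=1}}^{q^k}\left|\sum_{n=M+1}^{M+N} a_n\, e\!\left(\frac{a}{q^k}n\right)\right|^2 \ll (\log\log 10NQ)^{k+1}\left(Q^{k+1}+N+N^{1/2+\varepsilon}Q^k\right)Z,$$ where the implied constant depends only on $\varepsilon$ and $k$.
   Context: Here $q$ runs over natural numbers $q\le Q$. *)

theory Defs
  imports Complex_Main
begin

definition e :: "real \<Rightarrow> complex" where
  "e x = exp (2 * of_real pi * \<i> * of_real x)"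

end

theory Submission
  imports Defs "HOL-Analysis.Analysis" "HOL-Number_Theory.Number_Theory"
begin

text \<open>
  By Gallagher's form of the large sieve the sum is \<open><< K N Z\<close>, where \<open>K\<close> bounds the number of
  fractions \<open>b / q ^ k\<close> in a window of length \<open>1 / N\<close>. If \<open>N \<le> Q ^ k\<close>, counting each \<open>q\<close> separately
  gives \<open>K << Q ^ (k + 1) / N\<close>; if \<open>Q ^ (2 * k) < N\<close>, the spacing of the fractions gives \<open>K \<le> 1\<close>.
  In between, for \<open>q\<close> in a dyadic block \<open>X / 2 < q \<le> X\<close>, approximate the centre of the window by
  \<open>h / r\<close> with \<open>r \<le> sqrt N\<close>. The integer \<open>m = b * r - h * q ^ k\<close> is then small, and for given \<open>m\<close>
  the congruence \<open>h * q ^ k = - m\<close> modulo \<open>r\<close> leaves \<open>r ^ \<epsilon>\<close> residue classes for \<open>q\<close> and a short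
  interval, so that \<open>K << N ^ \<epsilon> * X ^ k / sqrt N\<close>. Since \<open>k \<ge> 2\<close>, the factor \<open>N ^ \<epsilon>\<close> absorbs all
  divisor sums and the iterated logarithm is only needed to be bounded below.
\<close>

text \<open>In the middle range three losses have to cancel. Let \<open>\<delta>\<close> be the
  distance from \<open>x\<close> to \<open>h / r\<close>, or \<open>1 / N\<close> if that is larger.
  A larger \<open>\<delta>\<close> admits more values of \<open>m\<close> but confines
  \<open>q\<close>, for each of them, to a shorter interval: the two bounds are proportional to
  \<open>\<delta>\<close> and \<open>1 / \<delta>\<close>, so their product is free of
  \<open>\<delta>\<close>. A common divisor \<open>d\<close> of \<open>q ^ k\<close> and
  \<open>r\<close> weakens the congruence to the modulus \<open>r / d\<close>, but it forces
  \<open>d dvd m\<close>, and the rarer \<open>m\<close> pay for it. The value \<open>m = 0\<close>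
  would spoil this second saving; it belongs to at most one fraction, \<open>h / r\<close> itself.
  The bound \<open>r <= sqrt N\<close> balances the Dirichlet error against the window: both
  contribute \<open>O(1 / sqrt N)\<close> to \<open>r * \<delta>\<close>. The hypothesis
  \<open>k >= 2\<close> enters through \<open>X ^ 2 <= X ^ k <= N\<close>, that is
  \<open>X <= sqrt N\<close>. The costs of the blocks form a geometric series, so no logarithm of
  their number appears.\<close>

section \<open>Divisors and roots of congruences\<close>

text \<open>For all but finitely many primes \<open>A <= p powr \<delta>\<close>, and there doubling
  the exponent absorbs the constant; the exceptional primes, the set \<open>S\<close> below, cost at
  most \<open>A ^ card S\<close> in total. A predicate \<open>P n a\<close> stands for
  "\<open>a\<close> is an upper bound at \<open>n\<close>" because in
  \<open>card_kth_roots_bound\<close> the bounded quantity is a supremum over sets.\<close>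

lemma submultiplicative_bound:
  fixes P :: "nat \<Rightarrow> real \<Rightarrow> bool" and A \<delta> :: real
  assumes "A \<ge> 1" "\<delta> > 0"
    and one: "P 1 1"
    and mono: "\<And>n a b. P n a \<Longrightarrow> a \<le> b \<Longrightarrow> P n b"
    and mult: "\<And>m n a b. \<lbrakk>m > 0; n > 0; coprime m n; 0 \<le> a; 0 \<le> b; P m a; P n b\<rbrakk> \<Longrightarrow> P (m * n) (a * b)"
    and prime_pow: "\<And>p j. prime p \<Longrightarrow> j > 0 \<Longrightarrow> P (p ^ j) (A * real (p ^ j) powr \<delta>)"
  shows "\<exists>C>0. \<forall>n>0. P n (C * real n powr (2 * \<delta>))"
proof -
  define S where "S = {p::nat. prime p \<and> real p powr \<delta> < A}"
  have "S \<subseteq> {..nat \<lceil>A powr (1 / \<delta>)\<rceil>}"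
  proof
    fix p assume "p \<in> S"
    then have p: "real p > 0" "real p powr \<delta> \<le> A"
      by (auto simp: S_def prime_gt_0_nat)
    have "real p = (real p powr \<delta>) powr (1 / \<delta>)"
      using p \<open>\<delta> > 0\<close> by (simp add: powr_powr)
    also have "\<dots> \<le> A powr (1 / \<delta>)"
      using p \<open>\<delta> > 0\<close> by (intro powr_mono2) auto
    finally show "p \<in> {..nat \<lceil>A powr (1 / \<delta>)\<rceil>}"
      by (simp, linarith)
  qed
  then have "finite S" by (rule finite_subset) auto
  have key: "P n (A ^ card (S \<inter> prime_factors n) * real n powr (2 * \<delta>))" if "n > 0" for n
    using that
  proof (induction n rule: less_induct)
    case (less n)
    show ?case
    proof (cases "n = 1")
      case True
      then show ?thesis using one by simp
    next
      case False
      then obtain p where p: "prime p" "p dvd n"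
        using prime_factor_nat by blast
      define j where "j = multiplicity p n"
      obtain m where m: "n = p ^ j * m" "\<not> p dvd m"
        using multiplicity_decompose'[of n p] p less.prems unfolding j_def
        by (metis not_prime_unit neq0_conv)
      have "j > 0" using m p by (metis gr0I mult_1 power_0)
      have "m > 0" using less.prems m by (auto intro: Nat.gr0I)
      have "coprime p m" using p m prime_imp_coprime by blast
      then have cop: "coprime (p ^ j) m" by simp
      have "p ^ j > 1" using p \<open>j > 0\<close> by (metis one_less_power prime_gt_1_nat)
      then have "m < n" using m \<open>m > 0\<close> by simp
      then have IH: "P m (A ^ card (S \<inter> prime_factors m) * real m powr (2 * \<delta>))"
        using less.IH \<open>m > 0\<close> by blast
      have pf: "prime_factors n = insert p (prime_factors m)"
        using p \<open>j > 0\<close> \<open>m > 0\<close> m(1)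
        by (simp add: prime_factors_product prime_factors_power prime_prime_factors)
      have pn: "p \<notin> prime_factors m" using m by auto
      \<comment> \<open>Primes in \<open>S\<close> keep the factor \<open>A\<close>; the others
        trade it for the second copy of \<open>(p ^ j) powr \<delta>\<close>.\<close>
      define B where "B = real (p ^ j) powr (2 * \<delta>) * (if p \<in> S then A else 1)"
      have "real (p ^ j) \<ge> 1"
        using \<open>p ^ j > 1\<close> by (metis less_imp_le of_nat_1 of_nat_le_iff)
      then have pj1: "real (p ^ j) powr \<delta> \<ge> 1"
        using \<open>\<delta> > 0\<close> by (intro ge_one_powr_ge_zero) auto
      have dbl: "x powr (2 * \<delta>) = x powr \<delta> * x powr \<delta>" for x :: real
        by (simp add: powr_add[symmetric])
      have "A * real (p ^ j) powr \<delta> \<le> B"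
      proof (cases "p \<in> S")
        case True
        have "real (p ^ j) powr \<delta> \<le> real (p ^ j) powr (2 * \<delta>)"
          unfolding dbl using pj1 by (metis mult_left_mono mult.right_neutral order.trans zero_le_one)
        then show ?thesis using True \<open>A \<ge> 1\<close>
          unfolding B_def by (simp add: mult.commute mult_right_mono)
      next
        case False
        have "A \<le> real p powr \<delta>" using False p by (auto simp: S_def)
        also have "\<dots> \<le> real (p ^ j) powr \<delta>"
          using p \<open>j > 0\<close> \<open>\<delta> > 0\<close> prime_ge_1_nat[of p]
          by (intro powr_mono2) (auto intro!: self_le_power)
        finally have "A * real (p ^ j) powr \<delta> \<le> real (p ^ j) powr (2 * \<delta>)"
          unfolding dbl by (intro mult_right_mono) auto
        then show ?thesis using False unfolding B_def by simp
      qed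
      then have "P (p ^ j) B" using prime_pow[OF p(1) \<open>j > 0\<close>] mono by blast
      then have "P (p ^ j * m) (B * (A ^ card (S \<inter> prime_factors m) * real m powr (2 * \<delta>)))"
        using \<open>p ^ j > 1\<close> \<open>m > 0\<close> \<open>A \<ge> 1\<close> cop IH prime_gt_0_nat[OF p(1)]
        by (intro mult) (auto simp: B_def)
      moreover have "B * (A ^ card (S \<inter> prime_factors m) * real m powr (2 * \<delta>))
          = A ^ card (S \<inter> prime_factors n) * real n powr (2 * \<delta>)"
      proof -
        have "A ^ card (S \<inter> prime_factors n) = (if p \<in> S then A else 1) * A ^ card (S \<inter> prime_factors m)"
          using pn unfolding pf by (auto simp: Int_insert_right)
        moreover have "real n powr (2 * \<delta>) = real (p ^ j) powr (2 * \<delta>) * real m powr (2 * \<delta>)"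
          unfolding m(1) of_nat_mult by (rule powr_mult)
        ultimately show ?thesis unfolding B_def by (simp only: mult_ac)
      qed
      ultimately show ?thesis using m(1) by simp
    qed
  qed
  show ?thesis
  proof (intro exI[of _ "A ^ card S"] conjI allI impI)
    show "A ^ card S > 0" using \<open>A \<ge> 1\<close> by simp
    fix n :: nat assume "n > 0"
    have "A ^ card (S \<inter> prime_factors n) \<le> A ^ card S"
      using \<open>A \<ge> 1\<close> \<open>finite S\<close> by (intro power_increasing card_mono) auto
    then show "P n (A ^ card S * real n powr (2 * \<delta>))"
      using key[OF \<open>n > 0\<close>] mono by (meson mult_right_mono powr_ge_zero)
  qed
qed

lemma card_divisors_bound:
  fixes \<epsilon> :: real
  assumes "\<epsilon> > 0"
  shows "\<exists>C>0. \<forall>n>0. real (card {d::nat. d dvd n}) \<le> C * real n powr \<epsilon>"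
proof -
  define \<delta> where "\<delta> = \<epsilon> / 2"
  have "\<delta> > 0" using assms by (simp add: \<delta>_def)
  \<comment> \<open>Chosen so that \<open>1 + j <= A * (1 + j * (\<delta> * ln 2)) <= A * 2 powr (j
    * \<delta>)\<close>, where \<open>1 + j\<close> counts the divisors of \<open>p ^ j\<close> and
    2 is the smallest prime.\<close>
  define A where "A = max 1 (1 / (\<delta> * ln 2))"
  have "\<exists>C>0. \<forall>n>0. real (card {d::nat. d dvd n}) \<le> C * real n powr (2 * \<delta>)"
  proof (rule submultiplicative_bound[where A = A])
    show "A \<ge> 1" "\<delta> > 0" using \<open>\<delta> > 0\<close> by (auto simp: A_def)
    show "real (card {d. d dvd (1::nat)}) \<le> 1" by simp
  next
    fix m n :: nat and a b :: real
    assume *: "m > 0" "n > 0" "coprime m n" "0 \<le> a" "0 \<le> b"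
      "real (card {d. d dvd m}) \<le> a" "real (card {d. d dvd n}) \<le> b"
    have "{d. d dvd m * n} \<subseteq> (\<lambda>(x, y). x * y) ` ({d. d dvd m} \<times> {d. d dvd n})"
    proof
      fix d assume "d \<in> {d. d dvd m * n}"
      then obtain x y where "d = x * y" "x dvd m" "y dvd n"
        by (metis mem_Collect_eq division_decomp)
      then show "d \<in> (\<lambda>(x, y). x * y) ` ({d. d dvd m} \<times> {d. d dvd n})" by force
    qed
    then have "card {d. d dvd m * n} \<le> card ({d. d dvd m} \<times> {d. d dvd n})"
      using * by (intro surj_card_le) auto
    then have "real (card {d. d dvd m * n}) \<le> real (card {d. d dvd m}) * real (card {d. d dvd n})"
      by (metis card_cartesian_product of_nat_le_iff of_nat_mult)
    also have "\<dots> \<le> a * b" using * by (intro mult_mono) auto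
    finally show "real (card {d. d dvd m * n}) \<le> a * b" .
  next
    fix p j :: nat assume p: "prime p" "j > 0"
    have "{d. d dvd p ^ j} \<subseteq> (\<lambda>i. p ^ i) ` {..j}"
      using p by (auto simp: divides_primepow_nat)
    then have "card {d. d dvd p ^ j} \<le> card {..j}" by (intro surj_card_le) auto
    then have "real (card {d. d dvd p ^ j}) \<le> 1 + real j" by simp
    also have "\<dots> \<le> A * (1 + real j * (\<delta> * ln 2))"
    proof -
      have "A * (\<delta> * ln 2) \<ge> 1"
        using \<open>\<delta> > 0\<close> unfolding A_def by (simp add: max_def field_simps)
      then have "real j * 1 \<le> real j * (A * (\<delta> * ln 2))" by (intro mult_left_mono) auto
      moreover have "A \<ge> 1" by (simp add: A_def)
      ultimately show ?thesis by (simp add: algebra_simps)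
    qed
    also have "\<dots> \<le> A * exp (real j * (\<delta> * ln 2))"
      by (intro mult_left_mono exp_ge_add_one_self) (auto simp: A_def)
    also have "A * exp (real j * (\<delta> * ln 2)) = A * (2 ^ j) powr \<delta>"
      by (simp add: powr_def ln_realpow mult_ac)
    also have "\<dots> \<le> A * real (p ^ j) powr \<delta>"
      using p \<open>\<delta> > 0\<close> prime_ge_2_nat[of p]
      by (intro mult_left_mono powr_mono2) (auto simp: A_def intro!: power_mono)
    finally show "real (card {d. d dvd p ^ j}) \<le> A * real (p ^ j) powr \<delta>" .
  qed auto
  then show ?thesis by (simp add: \<delta>_def)
qed

text \<open>Since \<open>(x ^ k - y ^ k) / (x - y)\<close> is congruent to \<open>k * x ^ (k - 1)\<close> modulo \<open>p ^ (e + 1)\<close>,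
  its \<open>p\<close>-adic valuation is exactly that of \<open>k\<close>.\<close>

lemma cong_prime_power_of_powers_cong:
  fixes x y :: int and k :: nat and p :: int
  assumes p: "prime p" and cop: "\<not> p dvd x" and "k > 0"
    and near: "[x = y] (mod p ^ Suc (multiplicity p (int k)))"
    and eq: "[x ^ k = y ^ k] (mod p ^ j)"
  shows "[x = y] (mod p ^ (j - multiplicity p (int k)))"
proof -
  define e where "e = multiplicity p (int k)"
  obtain l where k: "k = Suc l" using \<open>k > 0\<close> by (cases k) auto
  define S where "S = (\<Sum>i<k. x ^ i * y ^ (l - i))"
  have fac: "x ^ k - y ^ k = (x - y) * S"
    unfolding S_def k by (rule diff_power_eq_sum)
  have "[S = (\<Sum>i<k. x ^ l)] (mod p ^ Suc e)"
    unfolding S_def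
  proof (rule cong_sum)
    fix i assume "i \<in> {..<k}"
    then have "x ^ l = x ^ i * x ^ (l - i)" using k by (simp flip: power_add)
    moreover have "[x ^ i * y ^ (l - i) = x ^ i * x ^ (l - i)] (mod p ^ Suc e)"
      using near unfolding e_def by (intro cong_mult cong_pow cong_refl) (rule cong_sym)
    ultimately show "[x ^ i * y ^ (l - i) = x ^ l] (mod p ^ Suc e)" by simp
  qed
  then have "[S = int k * x ^ l] (mod p ^ Suc e)" by simp
  then obtain u where "S - int k * x ^ l = p ^ Suc e * u"
    unfolding cong_iff_dvd_diff by (elim dvdE)
  then have u: "S = int k * x ^ l + p ^ Suc e * u" by simp
  obtain w where w: "int k = p ^ e * w" "\<not> p dvd w"
    using multiplicity_decompose'[of "int k" p] p \<open>k > 0\<close> unfolding e_def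
    by (metis not_prime_unit of_nat_0_less_iff less_irrefl)
  define S' where "S' = w * x ^ l + p * u"
  have S': "S = p ^ e * S'" unfolding u S'_def w by (simp add: algebra_simps)
  have "\<not> p dvd w * x ^ l"
    using p w cop prime_dvd_mult_iff prime_dvd_power by blast
  then have "\<not> p dvd S'" unfolding S'_def by (simp add: dvd_add_left_iff)
  then have copS: "coprime (p ^ (j - e)) S'" using p by (simp add: prime_imp_coprime)
  \<comment> \<open>For \<open>j < e\<close> the subtraction truncates and the modulus is 1.\<close>
  have "p ^ (j - e) dvd (x - y) * S'"
  proof (cases "j \<ge> e")
    case True
    have "p ^ j dvd (x - y) * S" using eq fac by (simp add: cong_iff_dvd_diff)
    then have "p ^ e * p ^ (j - e) dvd p ^ e * ((x - y) * S')"
      unfolding S' using True by (simp add: mult_ac flip: power_add)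
    then show ?thesis using p by simp
  qed auto
  then have "p ^ (j - e) dvd x - y" using copS coprime_dvd_mult_left_iff by blast
  then show ?thesis by (simp add: cong_iff_dvd_diff e_def)
qed


text \<open>Let \<open>p ^ e\<close> be the exact power of \<open>p\<close> in \<open>k\<close>.
  There are at most \<open>k ^ 2\<close> residues modulo \<open>p ^ (e + 1)\<close>; each of them
  fixes \<open>x\<close> modulo \<open>p ^ (j - e)\<close>, which leaves at most
  \<open>p ^ e <= k\<close> residues modulo \<open>p ^ j\<close>. What matters is a bound
  independent of \<open>p\<close> and \<open>j\<close>.\<close>

lemma card_kth_roots_prime_power:
  fixes k p j :: nat and Y :: "nat set"
  assumes p: "prime p" and "k > 0" "j > 0"
    and cop: "\<And>x. x \<in> Y \<Longrightarrow> coprime x p"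
    and eq: "\<And>x y. x \<in> Y \<Longrightarrow> y \<in> Y \<Longrightarrow> [x ^ k = y ^ k] (mod p ^ j)"
  shows "card ((\<lambda>x. x mod p ^ j) ` Y) \<le> k ^ 3"
proof (cases "Y = {}")
  case False
  then obtain y0 where y0: "y0 \<in> Y" by blast
  define e where "e = multiplicity p k"
  obtain v where v: "k = p ^ e * v" "\<not> p dvd v"
    using multiplicity_decompose'[of k p] p \<open>k > 0\<close> unfolding e_def
    by (metis less_irrefl not_prime_unit)
  have e_int: "multiplicity (int p) (int k) = e"
    using v p by (intro multiplicity_decomposeI[of _ _ _ "int v"]) auto
  have "p > 0" using p by (rule prime_gt_0_nat)
  have "p ^ e \<le> k"
    using \<open>k > 0\<close> unfolding e_def by (intro dvd_imp_le multiplicity_dvd) auto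
  define W where "W = (\<lambda>x. x mod p ^ Suc e) ` Y"
  \<comment> \<open>If \<open>p\<close> does not divide \<open>k\<close>, a polynomial of degree
    \<open>k\<close> has at most \<open>k\<close> roots modulo \<open>p\<close>. Otherwise
    \<open>e >= 1\<close>, and all residues together number
    \<open>p ^ (e + 1) <= p ^ (2 * e) <= k ^ 2\<close>.\<close>
  have W: "card W \<le> k ^ 2"
  proof (cases "e = 0")
    case True
    have "W \<subseteq> {x \<in> {..<p}. [x ^ k = y0 ^ k] (mod p)}"
    proof
      fix w assume "w \<in> W"
      then obtain x where x: "x \<in> Y" "w = x mod p" using True by (auto simp: W_def)
      have "[x ^ k = y0 ^ k] (mod p)"
        using eq[OF x(1) y0] by (rule cong_dvd_modulus_nat) (simp add: \<open>j > 0\<close>)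
      moreover have "[w ^ k = x ^ k] (mod p)" unfolding x by (intro cong_pow) simp
      ultimately show "w \<in> {x \<in> {..<p}. [x ^ k = y0 ^ k] (mod p)}"
        using x \<open>p > 0\<close> by (auto intro: cong_trans)
    qed
    then have "card W \<le> card {x \<in> {..<p}. [x ^ k = y0 ^ k] (mod p)}"
      by (intro card_mono) auto
    also have "\<dots> \<le> k" using roots_mod_prime_bound[OF p \<open>k > 0\<close>] .
    also have "\<dots> \<le> k ^ 2" using \<open>k > 0\<close> by (simp add: power2_eq_square)
    finally show ?thesis .
  next
    case False
    have "W \<subseteq> {..<p ^ Suc e}" using \<open>p > 0\<close> by (auto simp: W_def)
    then have "card W \<le> p ^ Suc e" using card_mono[of "{..<p ^ Suc e}" W] by simp
    also have "\<dots> \<le> p ^ e * p ^ e"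
      using False \<open>p > 0\<close> by (simp add: self_le_power)
    also have "\<dots> \<le> k ^ 2"
      using \<open>p ^ e \<le> k\<close> by (simp add: power2_eq_square mult_mono)
    finally show ?thesis .
  qed
  \<comment> \<open>The second component consists of the base-\<open>p\<close> digits of
    \<open>x mod p ^ j\<close> above the last \<open>j - e\<close>. The first one determines those
    last digits by the preceding lemma, so \<open>h x\<close> determines \<open>x mod p ^ j\<close>.
    For \<open>j < e\<close> the divisor is \<open>p ^ 0 = 1\<close> and the second component is all
    of \<open>x mod p ^ j\<close>.\<close>
  define h where "h = (\<lambda>x. (x mod p ^ Suc e, (x mod p ^ j) div p ^ (j - e)))"
  have h_bound: "h ` Y \<subseteq> W \<times> {..<p ^ e}"
  proof -
    have "(x mod p ^ j) div p ^ (j - e) < p ^ e" for x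
    proof -
      have "x mod p ^ j < p ^ j" using \<open>p > 0\<close> by simp
      also have "p ^ j \<le> p ^ e * p ^ (j - e)"
        using \<open>p > 0\<close> by (auto intro!: power_increasing simp flip: power_add)
      finally show ?thesis by (rule less_mult_imp_div_less)
    qed
    then show ?thesis by (auto simp: h_def W_def)
  qed
  have h_inj: "x mod p ^ j = y mod p ^ j" if "x \<in> Y" "y \<in> Y" "h x = h y" for x y
  proof -
    have "[int x = int y] (mod int p ^ (j - e))"
    proof (rule cong_prime_power_of_powers_cong[of "int p" "int x" k "int y" j, unfolded e_int])
      show "\<not> int p dvd int x"
        using cop[OF that(1)] p by (metis coprime_common_divisor dvd_refl int_dvd_int_iff not_prime_unit)
      show "[int x = int y] (mod int p ^ Suc e)"
        using that(3) by (simp add: h_def cong_def flip: zmod_int of_nat_power of_nat_mult)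
      show "[int x ^ k = int y ^ k] (mod int p ^ j)"
        using eq[OF that(1,2)] by (simp add: cong_int_iff flip: of_nat_power)
    qed (use p \<open>k > 0\<close> in auto)
    then have "[x = y] (mod p ^ (j - e))" by (simp add: cong_int_iff flip: of_nat_power)
    then have "(x mod p ^ j) mod p ^ (j - e) = (y mod p ^ j) mod p ^ (j - e)"
      by (simp add: cong_def mod_mod_cancel le_imp_power_dvd)
    moreover have "(x mod p ^ j) div p ^ (j - e) = (y mod p ^ j) div p ^ (j - e)"
      using that(3) by (simp add: h_def)
    ultimately show ?thesis by (metis div_mult_mod_eq)
  qed
  have fin: "finite W"
    by (rule finite_subset[of _ "{..<p ^ Suc e}"]) (use \<open>p > 0\<close> in \<open>auto simp: W_def\<close>)
  then have "finite (h ` Y)" using h_bound by (meson finite_SigmaI finite_lessThan finite_subset)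
  have "(\<lambda>x. x mod p ^ j) ` Y \<subseteq> (\<lambda>z. inv_into Y h z mod p ^ j) ` (h ` Y)"
  proof
    fix w assume "w \<in> (\<lambda>x. x mod p ^ j) ` Y"
    then obtain x where "x \<in> Y" "w = x mod p ^ j" by auto
    moreover from this have "w = inv_into Y h (h x) mod p ^ j"
      using h_inj[of x "inv_into Y h (h x)"] by (simp add: inv_into_into f_inv_into_f)
    ultimately show "w \<in> (\<lambda>z. inv_into Y h z mod p ^ j) ` (h ` Y)" by blast
  qed
  then have "card ((\<lambda>x. x mod p ^ j) ` Y) \<le> card (h ` Y)"
    using \<open>finite (h ` Y)\<close> by (rule surj_card_le[rotated])
  also have "\<dots> \<le> card (W \<times> {..<p ^ e})"
    using h_bound fin by (intro card_mono) auto
  also have "\<dots> \<le> k ^ 2 * k"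
    using W \<open>p ^ e \<le> k\<close> by (simp add: card_cartesian_product mult_mono)
  finally show ?thesis by (simp add: power3_eq_cube power2_eq_square)
qed simp

text \<open>The Chinese remainder theorem makes the count submultiplicative, and the uniform prime
  power bound \<open>k ^ 3\<close> serves as \<open>A\<close>. Asking for pairwise congruent powers
  instead of a prescribed residue lets the hypothesis pass to the coprime factors of
  \<open>s\<close> unchanged.\<close>

lemma card_kth_roots_bound:
  fixes k :: nat and \<epsilon> :: real
  assumes "k > 0" "\<epsilon> > 0"
  shows "\<exists>C>0. \<forall>s>0. \<forall>Y. (\<forall>x\<in>Y. coprime x s) \<longrightarrow> (\<forall>x\<in>Y. \<forall>y\<in>Y. [x ^ k = y ^ k] (mod s)) \<longrightarrow>
    real (card ((\<lambda>x. x mod s) ` Y)) \<le> C * real s powr \<epsilon>"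
proof -
  define P where "P = (\<lambda>(s::nat) (B::real). \<forall>Y. (\<forall>x\<in>Y. coprime x s) \<longrightarrow>
    (\<forall>x\<in>Y. \<forall>y\<in>Y. [x ^ k = y ^ k] (mod s)) \<longrightarrow> real (card ((\<lambda>x. x mod s) ` Y)) \<le> B)"
  have "\<exists>C>0. \<forall>n>0. P n (C * real n powr (2 * (\<epsilon> / 2)))"
  proof (rule submultiplicative_bound[where A = "real k ^ 3"])
    show "real k ^ 3 \<ge> 1" "\<epsilon> / 2 > 0" using assms by auto
    have "card ((\<lambda>x. x mod 1) ` Y) \<le> 1" for Y :: "nat set"
      using card_mono[of "{0}" "(\<lambda>x. x mod 1) ` Y"] by auto
    then show "P 1 1" unfolding P_def by (simp del: mod_by_1 mod_by_Suc_0)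
    show "P n b" if "P n a" "a \<le> b" for n a b
      using that unfolding P_def by (meson order.trans)
  next
    fix m n :: nat and a b :: real
    assume *: "m > 0" "n > 0" "coprime m n" "0 \<le> a" "0 \<le> b" "P m a" "P n b"
    show "P (m * n) (a * b)"
      unfolding P_def
    proof (intro allI impI)
      fix Y :: "nat set"
      assume Y: "\<forall>x\<in>Y. coprime x (m * n)" "\<forall>x\<in>Y. \<forall>y\<in>Y. [x ^ k = y ^ k] (mod m * n)"
      let ?g = "\<lambda>x. (x mod m, x mod n)" and ?Y = "(\<lambda>x. x mod (m * n)) ` Y"
      have a: "real (card ((\<lambda>x. x mod m) ` Y)) \<le> a" and b: "real (card ((\<lambda>x. x mod n) ` Y)) \<le> b"
      proof -
        have "\<forall>x\<in>Y. coprime x m" "\<forall>x\<in>Y. coprime x n" using Y by auto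
        moreover have "\<forall>x\<in>Y. \<forall>y\<in>Y. [x ^ k = y ^ k] (mod m)" "\<forall>x\<in>Y. \<forall>y\<in>Y. [x ^ k = y ^ k] (mod n)"
          using Y(2) by (meson cong_dvd_modulus_nat dvd_triv_left dvd_triv_right)+
        ultimately show "real (card ((\<lambda>x. x mod m) ` Y)) \<le> a" "real (card ((\<lambda>x. x mod n) ` Y)) \<le> b"
          using *(6,7) unfolding P_def by blast+
      qed
      have "inj_on ?g ?Y"
      proof (rule inj_onI)
        fix x y assume xy: "x \<in> ?Y" "y \<in> ?Y" "?g x = ?g y"
        then have "[x = y] (mod m * n)"
          using * by (intro coprime_cong_mult_nat) (auto simp: cong_def)
        then show "x = y" using xy by (auto simp: cong_def)
      qed
      then have "card ?Y = card (?g ` ?Y)" by (simp add: card_image)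
      also have "\<dots> \<le> card ((\<lambda>x. x mod m) ` Y \<times> (\<lambda>x. x mod n) ` Y)"
      proof (rule card_mono)
        have "(\<lambda>x. x mod m) ` Y \<subseteq> {..<m}" "(\<lambda>x. x mod n) ` Y \<subseteq> {..<n}"
          using * by auto
        then show "finite ((\<lambda>x. x mod m) ` Y \<times> (\<lambda>x. x mod n) ` Y)"
          by (meson finite_SigmaI finite_lessThan finite_subset)
        show "?g ` ?Y \<subseteq> (\<lambda>x. x mod m) ` Y \<times> (\<lambda>x. x mod n) ` Y"
          by (auto simp: mod_mod_cancel)
      qed
      finally have "real (card ?Y) \<le> real (card ((\<lambda>x. x mod m) ` Y)) * real (card ((\<lambda>x. x mod n) ` Y))"
        by (metis card_cartesian_product of_nat_le_iff of_nat_mult)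
      also have "\<dots> \<le> a * b" using a b * by (intro mult_mono) auto
      finally show "real (card ?Y) \<le> a * b" .
    qed
  next
    fix p j :: nat assume p: "prime p" "j > 0"
    show "P (p ^ j) (real k ^ 3 * real (p ^ j) powr (\<epsilon> / 2))"
      unfolding P_def
    proof (intro allI impI)
      fix Y :: "nat set"
      assume Y: "\<forall>x\<in>Y. coprime x (p ^ j)" "\<forall>x\<in>Y. \<forall>y\<in>Y. [x ^ k = y ^ k] (mod p ^ j)"
      have "card ((\<lambda>x. x mod p ^ j) ` Y) \<le> k ^ 3"
        using p Y assms by (intro card_kth_roots_prime_power) auto
      then have "real (card ((\<lambda>x. x mod p ^ j) ` Y)) \<le> real k ^ 3 * 1"
        by (simp flip: of_nat_power)
      also have "\<dots> \<le> real k ^ 3 * real (p ^ j) powr (\<epsilon> / 2)"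
        using p assms prime_ge_1_nat[of p]
        by (intro mult_left_mono ge_one_powr_ge_zero) (auto simp flip: of_nat_power)
      finally show "real (card ((\<lambda>x. x mod p ^ j) ` Y)) \<le> real k ^ 3 * real (p ^ j) powr (\<epsilon> / 2)" .
    qed
  qed
  then show ?thesis unfolding P_def by simp
qed

section \<open>The large sieve for well-distributed points\<close>

lemma e_eq_cis: "e x = cis (2 * pi * x)"
  by (simp add: e_def cis_conv_exp mult_ac)

lemma norm_e [simp]: "cmod (e x) = 1"
  by (simp add: e_eq_cis)

lemma e_add: "e (x + y) = e x * e y"
  by (simp add: e_eq_cis cis_mult ring_distribs)

lemma cnj_e: "cnj (e x) = e (- x)"
  by (simp add: e_eq_cis cis_cnj)

lemma e_of_int [simp]: "e (of_int n) = 1"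
  by (simp add: e_eq_cis cis_multiple_2pi)

lemma e_has_vector_derivative:
  "((\<lambda>x. e (x * c)) has_vector_derivative 2 * pi * \<i> * c * e (x * c)) (at x within S)"
proof -
  have "((\<lambda>z. exp (2 * pi * \<i> * c * z)) has_field_derivative 2 * pi * \<i> * c * exp (2 * pi * \<i> * c * of_real x))
      (at (of_real x))"
    by (auto intro!: derivative_eq_intros)
  then have "((\<lambda>t. exp (2 * pi * \<i> * c * of_real t)) has_vector_derivative
      2 * pi * \<i> * c * exp (2 * pi * \<i> * c * of_real x)) (at x within S)"
    by (rule has_vector_derivative_real_field)
  then show ?thesis by (simp add: e_def mult_ac)
qed

lemma continuous_on_e [continuous_intros]:
  "continuous_on S f \<Longrightarrow> continuous_on S (\<lambda>x. e (f x))"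
  unfolding e_def by (intro continuous_intros)

text \<open>The integer endpoints make the exponentials orthogonal, and the interval contains every
  window of half-width at most \<open>1 / 2\<close> around a point of \<open>[0, 1]\<close>, so that
  windows never have to be wrapped modulo 1.\<close>

lemma has_integral_e_int:
  fixes m :: int
  shows "((\<lambda>x. e (x * of_int m)) has_integral (if m = 0 then 3 else 0)) {-1..2}"
proof (cases "m = 0")
  case True
  have "((\<lambda>x::real. 1 :: complex) has_integral 3) {-1..2}"
    using has_integral_const_real[of "1 :: complex" "-1" 2] by (simp add: scaleR_conv_of_real)
  then show ?thesis using True e_of_int[of 0] by simp
next
  case False
  define c where "c = 2 * pi * \<i> * of_int m"
  have "c \<noteq> 0" using False by (simp add: c_def)
  have "((\<lambda>x. e (x * of_int m)) has_integral e (2 * of_int m) / c - e (-1 * of_int m) / c) {-1..2}"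
  proof (rule fundamental_theorem_of_calculus)
    fix x :: real
    have "((\<lambda>x. e (x * of_int m) / c) has_vector_derivative c * e (x * of_int m) / c) (at x within {-1..2})"
      unfolding c_def using e_has_vector_derivative[of "of_int m" x]
      by (intro derivative_eq_intros) auto
    then show "((\<lambda>x. e (x * of_int m) / c) has_vector_derivative e (x * of_int m)) (at x within {-1..2})"
      using \<open>c \<noteq> 0\<close> by simp
  qed simp
  moreover have "e (2 * of_int m) = 1" "e (-1 * of_int m) = 1"
    using e_of_int[of "2 * m"] e_of_int[of "- m"] by simp_all
  ultimately show ?thesis using False by simp
qed

lemma trig_poly_parseval:
  fixes c :: "nat \<Rightarrow> complex"
  shows "((\<lambda>x. (cmod (\<Sum>n=1..N. c n * e (x * real n)))\<^sup>2) has_integral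
    3 * (\<Sum>n=1..N. (cmod (c n))\<^sup>2)) {-1..2}"
proof -
  have eq: "complex_of_real ((cmod (\<Sum>n=1..N. c n * e (x * real n)))\<^sup>2) =
      (\<Sum>n=1..N. \<Sum>m=1..N. c n * cnj (c m) * e (x * of_int (int n - int m)))" for x
  proof -
    have "e (x * of_int (int n - int m)) = e (x * real n) * cnj (e (x * real m))" for n m
      unfolding cnj_e e_add[symmetric] by (simp add: algebra_simps)
    then show ?thesis
      unfolding complex_norm_square by (simp add: sum_product mult_ac)
  qed
  have "((\<lambda>x. \<Sum>n=1..N. \<Sum>m=1..N. c n * cnj (c m) * e (x * of_int (int n - int m))) has_integral
      (\<Sum>n=1..N. \<Sum>m=1..N. c n * cnj (c m) * (if int n - int m = 0 then 3 else 0))) {-1..2}"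
    by (intro has_integral_sum has_integral_mult_right has_integral_e_int) auto
  moreover have "(\<Sum>n=1..N. \<Sum>m=1..N. c n * cnj (c m) * (if int n - int m = 0 then 3 else 0))
      = complex_of_real (3 * (\<Sum>n=1..N. (cmod (c n))\<^sup>2))"
    unfolding of_real_mult of_real_sum complex_norm_square
    by (simp add: if_distrib[of "(*) _"] sum_distrib_left mult_ac cong: if_cong)
  ultimately have "((\<lambda>x. complex_of_real ((cmod (\<Sum>n=1..N. c n * e (x * real n)))\<^sup>2)) has_integral
      complex_of_real (3 * (\<Sum>n=1..N. (cmod (c n))\<^sup>2))) {-1..2}"
    unfolding eq by simp
  from has_integral_linear[OF this bounded_linear_Re] show ?thesis
    by (simp add: o_def)
qed

text \<open>For every \<open>y\<close> in the window, \<open>\<phi> \<alpha>\<close> exceeds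
  \<open>\<phi> y\<close> by at most the integral of \<open>g\<close>; integrating this over
  \<open>y\<close> gives the claim. A continuous majorant \<open>g\<close> replaces
  \<open>\<bar>\<phi>'\<bar>\<close> because the application bounds the derivative by AM--GM before
  integrating.\<close>

lemma gallagher_sobolev:
  fixes \<phi> \<phi>' g :: "real \<Rightarrow> real"
  assumes deriv: "\<And>x. (\<phi> has_real_derivative \<phi>' x) (at x)"
    and le: "\<And>x. \<bar>\<phi>' x\<bar> \<le> g x" and cont: "continuous_on UNIV g"
    and \<alpha>: "u \<le> \<alpha>" "\<alpha> \<le> v"
  shows "(v - u) * \<phi> \<alpha> \<le> integral {u..v} \<phi> + (v - u) * integral {u..v} g"
proof -
  have g_int: "g integrable_on {a..b}" for a b
    using cont by (intro integrable_continuous_real) (rule continuous_on_subset, auto)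
  have g_nonneg: "g x \<ge> 0" for x using le[of x] by linarith
  have diff: "\<bar>\<phi> b - \<phi> a\<bar> \<le> integral {u..v} g" if "u \<le> a" "a \<le> b" "b \<le> v" for a b
  proof -
    have *: "(\<phi>' has_integral \<phi> b - \<phi> a) {a..b}"
      using that deriv
      by (intro fundamental_theorem_of_calculus)
        (auto intro: has_field_derivative_at_within simp flip: has_real_derivative_iff_has_vector_derivative)
    have "\<bar>\<phi> b - \<phi> a\<bar> \<le> integral {a..b} g"
      using integral_norm_bound_integral[OF has_integral_integrable[OF *] g_int] le
      by (simp add: integral_unique[OF *])
    also have "\<dots> \<le> integral {u..v} g"
      using that g_nonneg by (intro integral_subset_le g_int) auto
    finally show ?thesis .
  qed
  have "\<phi> \<alpha> \<le> \<phi> y + integral {u..v} g" if "y \<in> {u..v}" for y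
    using diff[of y \<alpha>] diff[of \<alpha> y] that \<alpha> by (cases "y \<le> \<alpha>") auto
  moreover have "continuous_on {u..v} \<phi>"
    using deriv by (meson DERIV_continuous_on has_field_derivative_at_within)
  then have phi: "\<phi> integrable_on {u..v}" by (rule integrable_continuous_real)
  ultimately have "integral {u..v} (\<lambda>y. \<phi> \<alpha>) \<le> integral {u..v} (\<lambda>y. \<phi> y + integral {u..v} g)"
    by (intro integral_le integrable_add) auto
  also have "\<dots> = integral {u..v} \<phi> + integral {u..v} (\<lambda>y. integral {u..v} g)"
    using phi by (intro integral_add) auto
  finally show ?thesis using \<alpha> by simp
qed

text \<open>Gallagher's argument.  AM--GM in the form
  \<open>2 * cmod T * cmod T' \<le> N * (cmod T)\<^sup>2 + (cmod T')\<^sup>2 / N\<close> takes the place of the Cauchy--Schwarz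
  inequality for integrals.\<close>

lemma large_sieve_nat:
  fixes \<alpha> :: "'i \<Rightarrow> real" and b :: "nat \<Rightarrow> complex" and K :: real
  assumes "finite I" "N \<ge> 1" and \<alpha>: "\<And>i. i \<in> I \<Longrightarrow> 0 \<le> \<alpha> i \<and> \<alpha> i \<le> 1"
    and K: "\<And>x. real (card {i \<in> I. \<bar>\<alpha> i - x\<bar> \<le> 1 / (2 * real N)}) \<le> K"
  shows "(\<Sum>i\<in>I. (cmod (\<Sum>n=1..N. b n * e (\<alpha> i * real n)))\<^sup>2)
    \<le> (6 + 12 * pi\<^sup>2) * K * real N * (\<Sum>n=1..N. (cmod (b n))\<^sup>2)"
proof -
  define h where "h = 1 / (2 * real N)"
  have h: "0 < h" "h \<le> 1 / 2" "2 * h * real N = 1" using \<open>N \<ge> 1\<close> by (auto simp: h_def field_simps)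
  define T where "T = (\<lambda>x. \<Sum>n=1..N. b n * e (x * real n))"
  define T' where "T' = (\<lambda>x. \<Sum>n=1..N. (b n * (2 * pi * \<i> * real n)) * e (x * real n))"
  define \<phi> where "\<phi> = (\<lambda>x. (cmod (T x))\<^sup>2)"
  define g where "g = (\<lambda>x. real N * (cmod (T x))\<^sup>2 + (cmod (T' x))\<^sup>2 / real N)"
  \<comment> \<open>On a window of length \<open>2 * h = 1 / N\<close>, the Sobolev inequality
    multiplied by \<open>N\<close> says that \<open>\<phi> y\<close> is at most the integral of
    \<open>G\<close>.\<close>
  define G where "G = (\<lambda>x. real N * \<phi> x + g x)"
  have contT: "continuous_on S T" "continuous_on S T'" for S
    unfolding T_def T'_def by (intro continuous_intros)+
  have contg: "continuous_on S g" and cont\<phi>: "continuous_on S \<phi>" and contG: "continuous_on S G" for S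
    unfolding g_def G_def \<phi>_def using \<open>N \<ge> 1\<close> by (auto intro!: continuous_intros contT)
  have intg: "g integrable_on {u..v}" and int\<phi>: "\<phi> integrable_on {u..v}" and intG: "G integrable_on {u..v}" for u v
    by (intro integrable_continuous_real contg cont\<phi> contG)+
  have g0: "g x \<ge> 0" and G0: "G x \<ge> 0" for x unfolding g_def G_def \<phi>_def by auto
  have "((\<lambda>x. b n * e (x * real n)) has_vector_derivative (b n * (2 * pi * \<i> * real n)) * e (x * real n)) (at x)" for n x
    using has_vector_derivative_mult_right[OF e_has_vector_derivative[of "real n" x UNIV], of "b n"]
    by (simp add: mult_ac)
  then have dT: "(T has_vector_derivative T' x) (at x)" for x
    unfolding T_def T'_def by (intro has_vector_derivative_sum)
  have d\<phi>: "(\<phi> has_real_derivative 2 * (T x \<bullet> T' x)) (at x)" for x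
  proof -
    have "((\<lambda>x. T x \<bullet> T x) has_derivative (\<lambda>y. T x \<bullet> (y *\<^sub>R T' x) + (y *\<^sub>R T' x) \<bullet> T x)) (at x)"
      using dT[of x] unfolding has_vector_derivative_def by (intro has_derivative_inner)
    then show ?thesis
      unfolding \<phi>_def has_field_derivative_def power2_norm_eq_inner
      by (rule has_derivative_eq_rhs) (auto simp: inner_commute fun_eq_iff)
  qed
  have le_g: "\<bar>2 * (T x \<bullet> T' x)\<bar> \<le> g x" for x
  proof -
    have "\<bar>T x \<bullet> T' x\<bar> \<le> cmod (T x) * cmod (T' x)" by (rule Cauchy_Schwarz_ineq2)
    moreover have "0 \<le> (real N * cmod (T x) - cmod (T' x))\<^sup>2 / real N" by simp
    then have "2 * (cmod (T x) * cmod (T' x)) \<le> g x"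
      using \<open>N \<ge> 1\<close> unfolding g_def by (simp add: power2_diff field_simps power2_eq_square)
    ultimately show ?thesis by linarith
  qed
  have point: "\<phi> y \<le> integral {y - h..y + h} G" for y
  proof -
    have "2 * h * \<phi> y \<le> integral {y - h..y + h} \<phi> + 2 * h * integral {y - h..y + h} g"
      using gallagher_sobolev[OF d\<phi> le_g contg, of "y - h" y "y + h"] h by simp
    then have "real N * (2 * h * \<phi> y) \<le> real N * (integral {y - h..y + h} \<phi> + 2 * h * integral {y - h..y + h} g)"
      by (intro mult_left_mono) auto
    moreover have "real N * (2 * h * t) = t" for t using h(3) by (metis mult.commute mult.left_commute mult_1)
    ultimately have "\<phi> y \<le> real N * integral {y - h..y + h} \<phi> + integral {y - h..y + h} g"
      by (simp only: distrib_left)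
    also have "\<dots> = integral {y - h..y + h} G"
      unfolding G_def using int\<phi> intg by (subst integral_add) (auto intro: integrable_on_mult_right)
    finally show ?thesis .
  qed
  let ?w = "\<lambda>i x. if x \<in> {\<alpha> i - h..\<alpha> i + h} then G x else 0"
  have w: "(?w i has_integral integral {\<alpha> i - h..\<alpha> i + h} G) {-1..2}" if "i \<in> I" for i
  proof -
    have "{\<alpha> i - h..\<alpha> i + h} \<subseteq> {-1..2}" using \<alpha>[OF that] h by auto
    then show ?thesis using intG by (simp only: has_integral_restrict integrable_integral)
  qed
  have "(\<Sum>i\<in>I. \<phi> (\<alpha> i)) \<le> (\<Sum>i\<in>I. integral {\<alpha> i - h..\<alpha> i + h} G)"
    by (intro sum_mono point)
  also have "\<dots> \<le> K * integral {-1..2} G"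
  proof (rule has_integral_le)
    show "((\<lambda>x. \<Sum>i\<in>I. ?w i x) has_integral (\<Sum>i\<in>I. integral {\<alpha> i - h..\<alpha> i + h} G)) {-1..2}"
      using \<open>finite I\<close> w by (intro has_integral_sum) auto
    show "((\<lambda>x. K * G x) has_integral K * integral {-1..2} G) {-1..2}"
      by (intro has_integral_mult_right integrable_integral intG)
    fix x :: real
    \<comment> \<open>A point \<open>x\<close> lies in the window of \<open>\<alpha> i\<close>
      exactly when \<open>\<alpha> i\<close> lies in the window of \<open>x\<close>, so the
      hypothesis on \<open>K\<close> bounds the overlap pointwise.\<close>
    have "(\<Sum>i\<in>I. ?w i x) = (\<Sum>i\<in>{i \<in> I. x \<in> {\<alpha> i - h..\<alpha> i + h}}. G x)"
      using \<open>finite I\<close> by (subst sum.inter_filter) auto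
    also have "\<dots> = real (card {i \<in> I. \<bar>\<alpha> i - x\<bar> \<le> 1 / (2 * real N)}) * G x"
    proof -
      have "{i \<in> I. x \<in> {\<alpha> i - h..\<alpha> i + h}} = {i \<in> I. \<bar>\<alpha> i - x\<bar> \<le> 1 / (2 * real N)}"
        unfolding h_def by (auto simp: abs_le_iff)
      then show ?thesis by simp
    qed
    also have "\<dots> \<le> K * G x" by (intro mult_right_mono K G0)
    finally show "(\<Sum>i\<in>I. ?w i x) \<le> K * G x" .
  qed
  also have "\<dots> \<le> K * ((6 + 12 * pi\<^sup>2) * real N * (\<Sum>n=1..N. (cmod (b n))\<^sup>2))"
  proof (rule mult_left_mono)
    define Z where "Z = (\<Sum>n=1..N. (cmod (b n))\<^sup>2)"
    define Z' where "Z' = (\<Sum>n=1..N. (cmod (b n * (2 * pi * \<i> * real n)))\<^sup>2)"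
    have "Z' \<le> (\<Sum>n=1..N. (4 * pi\<^sup>2 * (real N)\<^sup>2) * (cmod (b n))\<^sup>2)"
      unfolding Z'_def
    proof (rule sum_mono)
      fix n assume n: "n \<in> {1..N}"
      have "(cmod (b n * (2 * pi * \<i> * real n)))\<^sup>2 = (4 * pi\<^sup>2 * (real n)\<^sup>2) * (cmod (b n))\<^sup>2"
        by (simp add: norm_mult power_mult_distrib)
      also have "\<dots> \<le> (4 * pi\<^sup>2 * (real N)\<^sup>2) * (cmod (b n))\<^sup>2"
        using n by (intro mult_right_mono mult_left_mono power_mono) auto
      finally show "(cmod (b n * (2 * pi * \<i> * real n)))\<^sup>2 \<le> (4 * pi\<^sup>2 * (real N)\<^sup>2) * (cmod (b n))\<^sup>2" .
    qed
    then have Z': "Z' \<le> 4 * pi\<^sup>2 * (real N)\<^sup>2 * Z" by (simp add: Z_def sum_distrib_left)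
    \<comment> \<open>The interval has length 3, so \<open>N * \<phi>\<close> and the first part of
      \<open>g\<close> give \<open>3 * N * Z\<close> each, and \<open>T'\<close> gives at most
      \<open>12 * pi ^ 2 * N * Z\<close>: this is the origin of
      \<open>6 + 12 * pi ^ 2\<close>.\<close>
    have "(G has_integral real N * (3 * Z) + (real N * (3 * Z) + (3 * Z') / real N)) {-1..2}"
      unfolding G_def g_def \<phi>_def T_def T'_def Z_def Z'_def
      by (intro has_integral_add has_integral_mult_right has_integral_divide trig_poly_parseval)
    then have "integral {-1..2} G = 6 * real N * Z + 3 * Z' / real N"
      by (simp add: integral_unique)
    also have "\<dots> \<le> 6 * real N * Z + 3 * (4 * pi\<^sup>2 * (real N)\<^sup>2 * Z) / real N"
      using Z' by (intro add_left_mono divide_right_mono mult_left_mono) auto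
    also have "\<dots> = (6 + 12 * pi\<^sup>2) * real N * Z"
      using \<open>N \<ge> 1\<close> by (simp add: field_simps power2_eq_square)
    finally show "integral {-1..2} G \<le> (6 + 12 * pi\<^sup>2) * real N * (\<Sum>n=1..N. (cmod (b n))\<^sup>2)"
      unfolding Z_def .
    show "K \<ge> 0" using K[of 0] by (meson of_nat_0_le_iff order.trans)
  qed
  finally show ?thesis by (simp add: \<phi>_def T_def mult_ac)
qed

text \<open>Shifting the summation range by \<open>M\<close> multiplies each inner sum by the
  unimodular number \<open>e (\<alpha> i * M)\<close>.\<close>

lemma large_sieve:
  fixes \<alpha> :: "'i \<Rightarrow> real" and a :: "int \<Rightarrow> complex" and K :: real and M :: int
  assumes "finite I" "N \<ge> 1" and "\<And>i. i \<in> I \<Longrightarrow> 0 \<le> \<alpha> i \<and> \<alpha> i \<le> 1"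
    and "\<And>x. real (card {i \<in> I. \<bar>\<alpha> i - x\<bar> \<le> 1 / (2 * real N)}) \<le> K"
  shows "(\<Sum>i\<in>I. (cmod (\<Sum>n = M + 1..M + int N. a n * e (\<alpha> i * of_int n)))\<^sup>2)
    \<le> (6 + 12 * pi\<^sup>2) * K * real N * (\<Sum>n = M + 1..M + int N. (cmod (a n))\<^sup>2)"
proof -
  have shift: "(\<Sum>n = M + 1..M + int N. f n) = (\<Sum>n=1..N. f (M + int n))" for f :: "int \<Rightarrow> 'b :: comm_monoid_add"
    by (rule sum.reindex_bij_witness[of _ "\<lambda>n. M + int n" "\<lambda>n. nat (n - M)"]) auto
  have "cmod (\<Sum>n = M + 1..M + int N. a n * e (\<alpha> i * of_int n))
      = cmod (\<Sum>n=1..N. a (M + int n) * e (\<alpha> i * real n))" for i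
  proof -
    have "(\<Sum>n = M + 1..M + int N. a n * e (\<alpha> i * of_int n))
        = e (\<alpha> i * of_int M) * (\<Sum>n=1..N. a (M + int n) * e (\<alpha> i * real n))"
      unfolding shift sum_distrib_left by (simp add: distrib_left e_add mult_ac)
    then show ?thesis by (simp add: norm_mult)
  qed
  then show ?thesis
    unfolding shift using large_sieve_nat[OF assms, where b = "\<lambda>n. a (M + int n)"] by simp
qed

section \<open>Counting fractions with power denominators\<close>

lemma card_le_diameter:
  fixes W :: "nat set"
  assumes "finite W" "L \<ge> 0" and diam: "\<And>x y. x \<in> W \<Longrightarrow> y \<in> W \<Longrightarrow> \<bar>real x - real y\<bar> \<le> L"
  shows "real (card W) \<le> L + 1"
proof (cases "W = {}")
  case False
  define w where "w = Min W"
  have w: "w \<in> W" "\<And>x. x \<in> W \<Longrightarrow> w \<le> x" using \<open>finite W\<close> False by (auto simp: w_def)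
  have "W \<subseteq> {w..w + nat \<lfloor>L\<rfloor>}"
  proof
    fix x assume x: "x \<in> W"
    then have "real (x - w) \<le> L" using diam[OF x w(1)] w(2)[OF x] by (simp add: of_nat_diff)
    then have "x - w \<le> nat \<lfloor>L\<rfloor>" by (simp add: le_nat_floor)
    then show "x \<in> {w..w + nat \<lfloor>L\<rfloor>}" using w(2)[OF x] by simp
  qed
  then have "card W \<le> card {w..w + nat \<lfloor>L\<rfloor>}" by (intro card_mono) auto
  then show ?thesis using \<open>L \<ge> 0\<close> by simp linarith
qed (use assms in simp)

lemma card_le_residue_classes:
  fixes F :: "nat set" and s :: nat and D T :: real
  assumes "finite F" "s > 0" "D \<ge> 0"
    and diam: "\<And>x y. x \<in> F \<Longrightarrow> y \<in> F \<Longrightarrow> \<bar>real x - real y\<bar> \<le> D"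
    and T: "real (card ((\<lambda>x. x mod s) ` F)) \<le> T"
  shows "real (card F) \<le> T * (D / real s + 1)"
proof -
  have fib: "real (card {x \<in> F. x mod s = c}) \<le> D / real s + 1" for c
  proof -
    let ?F = "{x \<in> F. x mod s = c}"
    have inj: "inj_on (\<lambda>x. x div s) ?F"
      by (rule inj_onI) (metis (mono_tags, lifting) div_mult_mod_eq mem_Collect_eq)
    have "real (card ((\<lambda>x. x div s) ` ?F)) \<le> D / real s + 1"
    proof (rule card_le_diameter)
      fix x y assume "x \<in> (\<lambda>x. x div s) ` ?F" "y \<in> (\<lambda>x. x div s) ` ?F"
      then obtain x' y' where xy: "x' \<in> F" "y' \<in> F" "x' mod s = c" "y' mod s = c" "x = x' div s" "y = y' div s"
        by auto
      have "real x' = real x * real s + real c" "real y' = real y * real s + real c"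
        using xy by (metis div_mult_mod_eq of_nat_add of_nat_mult)+
      then have "real x' - real y' = (real x - real y) * real s" by (simp add: algebra_simps)
      then have "\<bar>real x - real y\<bar> * real s \<le> D"
        using diam[OF xy(1,2)] by (simp add: abs_mult)
      then show "\<bar>real x - real y\<bar> \<le> D / real s" using \<open>s > 0\<close> by (simp add: field_simps)
    qed (use assms in auto)
    then show ?thesis by (simp add: card_image[OF inj])
  qed
  have "card (\<Union>c\<in>(\<lambda>x. x mod s) ` F. {x \<in> F. x mod s = c})
      \<le> (\<Sum>c\<in>(\<lambda>x. x mod s) ` F. card {x \<in> F. x mod s = c})"
    using \<open>finite F\<close> by (intro card_UN_le) auto
  moreover have "(\<Union>c\<in>(\<lambda>x. x mod s) ` F. {x \<in> F. x mod s = c}) = F" by auto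
  ultimately have "real (card F) \<le> (\<Sum>c\<in>(\<lambda>x. x mod s) ` F. real (card {x \<in> F. x mod s = c}))"
    by (metis of_nat_le_iff of_nat_sum)
  also have "\<dots> \<le> real (card ((\<lambda>x. x mod s) ` F)) * (D / real s + 1)"
    by (rule sum_bounded_above[OF fib])
  also have "\<dots> \<le> T * (D / real s + 1)"
    using T \<open>D \<ge> 0\<close> by (intro mult_right_mono) auto
  finally show ?thesis .
qed

text \<open>Leaving out 0 avoids a term \<open>+ 1\<close>, so that the saving of a full factor
  \<open>d\<close> survives even when \<open>V < d\<close>.\<close>

lemma card_nonzero_multiples_le:
  fixes d :: nat and V :: real
  assumes "d > 0" "V \<ge> 0"
  shows "finite {m::int. m \<noteq> 0 \<and> int d dvd m \<and> \<bar>of_int m\<bar> \<le> V}"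
    and "real (card {m::int. m \<noteq> 0 \<and> int d dvd m \<and> \<bar>of_int m\<bar> \<le> V}) \<le> 2 * V / real d"
proof -
  define L where "L = \<lfloor>V / real d\<rfloor>"
  have "L \<ge> 0" using assms by (simp add: L_def)
  have sub: "{m::int. m \<noteq> 0 \<and> int d dvd m \<and> \<bar>of_int m\<bar> \<le> V} \<subseteq> (\<lambda>t. int d * t) ` ({1..L} \<union> {-L..-1})"
  proof
    fix m :: int assume "m \<in> {m. m \<noteq> 0 \<and> int d dvd m \<and> \<bar>of_int m\<bar> \<le> V}"
    then obtain t where t: "m = int d * t" "m \<noteq> 0" "\<bar>real_of_int m\<bar> \<le> V" by auto
    then have "real_of_int \<bar>t\<bar> \<le> V / real d" using \<open>d > 0\<close> by (simp add: abs_mult field_simps)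
    then have "\<bar>t\<bar> \<le> L" unfolding L_def by (simp only: le_floor_iff)
    moreover have "t \<noteq> 0" using t by auto
    ultimately have "t \<in> {1..L} \<union> {-L..-1}" by auto
    then show "m \<in> (\<lambda>t. int d * t) ` ({1..L} \<union> {-L..-1})" using t by blast
  qed
  show "finite {m::int. m \<noteq> 0 \<and> int d dvd m \<and> \<bar>of_int m\<bar> \<le> V}"
    using sub by (rule finite_subset) auto
  have "card {m::int. m \<noteq> 0 \<and> int d dvd m \<and> \<bar>of_int m\<bar> \<le> V} \<le> card ({1..L} \<union> {-L..-1})"
    using sub by (intro surj_card_le) auto
  also have "\<dots> \<le> card {1..L} + card {-L..-1}" by (rule card_Un_le)
  also have "\<dots> = 2 * nat L" by simp
  finally have "real (card {m::int. m \<noteq> 0 \<and> int d dvd m \<and> \<bar>of_int m\<bar> \<le> V}) \<le> 2 * real_of_int L"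
    using \<open>L \<ge> 0\<close> by linarith
  moreover have "real_of_int L \<le> V / real d" unfolding L_def by (rule of_int_floor_le)
  ultimately show "real (card {m::int. m \<noteq> 0 \<and> int d dvd m \<and> \<bar>of_int m\<bar> \<le> V}) \<le> 2 * V / real d"
    by simp
qed

text \<open>A mean value inequality. With \<open>c = X / 2\<close> it turns closeness of
  \<open>q ^ k\<close> and \<open>q' ^ k\<close> into closeness of \<open>q\<close> and
  \<open>q'\<close>, at the cost of a factor \<open>2 ^ (k - 1)\<close>; this is why the moduli are
  confined to dyadic blocks.\<close>

lemma abs_diff_power_ge:
  fixes a b c :: real
  assumes "0 \<le> c" "c \<le> a" "c \<le> b" "k > 0"
  shows "\<bar>a - b\<bar> * c ^ (k - 1) \<le> \<bar>a ^ k - b ^ k\<bar>"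
proof -
  obtain l where k: "k = Suc l" using \<open>k > 0\<close> by (cases k) auto
  have *: "(x - y) * c ^ l \<le> x ^ k - y ^ k" if "c \<le> y" "y \<le> x" for x y
  proof -
    have "(x - y) * c ^ l \<le> (x - y) * x ^ l"
      using that \<open>0 \<le> c\<close> by (intro mult_left_mono power_mono) auto
    moreover have "y * y ^ l \<le> y * x ^ l"
      using that \<open>0 \<le> c\<close> by (intro mult_left_mono power_mono) auto
    ultimately show ?thesis unfolding k by (simp add: algebra_simps)
  qed
  show ?thesis
    using *[of b a] *[of a b] assms k by (cases "b \<le> a") (auto simp: abs_if power_mono)
qed

text \<open>The set of \<open>x\<close> with \<open>d dvd x ^ k\<close> is closed under gcd, so its least positive element \<open>f\<close>
  divides all of them. Dividing by \<open>f\<close> makes the elements coprime to \<open>r div d\<close>.\<close>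

lemma coprime_part_of_congruent_powers:
  fixes k r d :: nat and F :: "nat set"
  assumes "k > 0" "r > 0" "d dvd r"
    and pos: "\<And>q. q \<in> F \<Longrightarrow> q > 0" and gcd: "\<And>q. q \<in> F \<Longrightarrow> gcd (q ^ k) r = d"
    and eq: "\<And>x y. x \<in> F \<Longrightarrow> y \<in> F \<Longrightarrow> [x ^ k = y ^ k] (mod r)"
  obtains f where "f > 0" "\<And>q. q \<in> F \<Longrightarrow> f dvd q"
    "\<And>q. q \<in> F \<Longrightarrow> coprime (q div f) (r div d)"
    "\<And>x y. x \<in> F \<Longrightarrow> y \<in> F \<Longrightarrow> [(x div f) ^ k = (y div f) ^ k] (mod r div d)"
proof -
  have "d > 0" using assms(2,3) by (auto intro: Nat.gr0I)
  define f where "f = (LEAST x. x > 0 \<and> d dvd x ^ k)"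
  have "d > 0 \<and> d dvd d ^ k" using \<open>d > 0\<close> \<open>k > 0\<close> by simp
  then have f: "f > 0" "d dvd f ^ k" unfolding f_def by (metis (mono_tags, lifting) LeastI)+
  have f_dvd: "f dvd q" if "q \<in> F" for q
  proof -
    have "d dvd q ^ k" using gcd[OF that] by (metis gcd_dvd1)
    then have "d dvd (gcd f q) ^ k" using f(2) by (simp flip: gcd_exp)
    then have "f \<le> gcd f q"
      using f(1) Least_le[of "\<lambda>x. x > 0 \<and> d dvd x ^ k" "gcd f q", folded f_def] by simp
    then show ?thesis using f(1) by (metis gcd_dvd1 gcd_dvd2 dvd_imp_le dvd_antisym le_antisym)
  qed
  obtain g where g: "f ^ k = d * g" using f(2) by (elim dvdE)
  obtain s where s: "r = d * s" using assms(3) by (elim dvdE)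
  have rd: "r div d = s" using s \<open>d > 0\<close> by simp
  have q_eq: "q ^ k = d * (g * (q div f) ^ k)" if "q \<in> F" for q
  proof -
    have "q ^ k = f ^ k * (q div f) ^ k"
      using f_dvd[OF that] by (simp flip: power_mult_distrib)
    then show ?thesis using g by simp
  qed
  \<comment> \<open>This yields two facts at once: \<open>q div f\<close> is coprime to
    \<open>s\<close>, and so is \<open>g\<close>, which can therefore be cancelled from the
    congruence between the powers.\<close>
  have cop: "coprime (g * (q div f) ^ k) s" if "q \<in> F" for q
  proof -
    have "gcd (d * (g * (q div f) ^ k)) (d * s) = d"
      using gcd[OF that] by (simp only: q_eq[OF that, symmetric] s[symmetric])
    then have "d * gcd (g * (q div f) ^ k) s = d * 1"
      using gcd_mult_distrib_nat[of d "g * (q div f) ^ k" s] by linarith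
    then show ?thesis using \<open>d > 0\<close> by (simp only: nat_mult_eq_cancel1 coprime_iff_gcd_eq_1)
  qed
  show thesis
  proof (rule that[OF f(1) f_dvd])
    show "coprime (q div f) (r div d)" if "q \<in> F" for q
      using cop[OF that] \<open>k > 0\<close> by (simp add: rd)
    fix x y assume xy: "x \<in> F" "y \<in> F"
    have "[d * (g * (x div f) ^ k) = d * (g * (y div f) ^ k)] (mod d * s)"
      using eq[OF xy] unfolding q_eq[OF xy(1)] q_eq[OF xy(2)] s .
    then have "[g * (x div f) ^ k = g * (y div f) ^ k] (mod s)"
      unfolding Cong.cong_def mod_mult_mult1 by (simp only: nat_mult_eq_cancel1[OF \<open>d > 0\<close>])
    moreover have "coprime g s" using cop[OF xy(1)] by simp
    ultimately show "[(x div f) ^ k = (y div f) ^ k] (mod r div d)"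
      by (simp add: rd cong_mult_lcancel_nat)
  qed
qed

text \<open>After division by the common factor \<open>f\<close> the elements are units modulo
  \<open>s = r div d\<close>. They fall into \<open>O(s powr \<epsilon>)\<close> residue classes,
  and each class meets an interval of length \<open>D\<close> in at most \<open>D / s + 1\<close>
  points.\<close>

lemma card_congruent_powers_bound:
  fixes k :: nat and \<epsilon> :: real
  assumes "k > 0" "\<epsilon> > 0"
  shows "\<exists>C>0. \<forall>r d (F :: nat set) D. r > 0 \<longrightarrow> d dvd r \<longrightarrow> finite F \<longrightarrow> D \<ge> 0 \<longrightarrow>
    (\<forall>q\<in>F. q > 0 \<and> gcd (q ^ k) r = d) \<longrightarrow> (\<forall>x\<in>F. \<forall>y\<in>F. [x ^ k = y ^ k] (mod r)) \<longrightarrow>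
    (\<forall>x\<in>F. \<forall>y\<in>F. \<bar>real x - real y\<bar> \<le> D) \<longrightarrow>
    real (card F) \<le> C * real r powr \<epsilon> * (D * real d / real r + 1)"
proof -
  obtain C where "C > 0" and C: "\<And>s Y. s > 0 \<Longrightarrow> (\<forall>x\<in>Y. coprime x s) \<Longrightarrow>
      (\<forall>x\<in>Y. \<forall>y\<in>Y. [x ^ k = y ^ k] (mod s)) \<Longrightarrow>
      real (card ((\<lambda>x. x mod s) ` Y)) \<le> C * real s powr \<epsilon>"
    using card_kth_roots_bound[OF assms] by metis
  have main: "real (card F) \<le> C * real r powr \<epsilon> * (D * real d / real r + 1)"
    if rd: "r > 0" "d dvd r" "finite F" "D \<ge> 0"
      and F: "\<And>q. q \<in> F \<Longrightarrow> q > 0" "\<And>q. q \<in> F \<Longrightarrow> gcd (q ^ k) r = d"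
        "\<And>x y. x \<in> F \<Longrightarrow> y \<in> F \<Longrightarrow> [x ^ k = y ^ k] (mod r)"
      and diam: "\<And>x y. x \<in> F \<Longrightarrow> y \<in> F \<Longrightarrow> \<bar>real x - real y\<bar> \<le> D"
    for r d :: nat and F :: "nat set" and D
  proof -
    obtain f where f: "f > 0" "\<And>q. q \<in> F \<Longrightarrow> f dvd q"
        "\<And>q. q \<in> F \<Longrightarrow> coprime (q div f) (r div d)"
        "\<And>x y. x \<in> F \<Longrightarrow> y \<in> F \<Longrightarrow> [(x div f) ^ k = (y div f) ^ k] (mod r div d)"
      using coprime_part_of_congruent_powers[OF \<open>k > 0\<close> rd(1,2) F] by blast
    define s where "s = r div d"
    have rs: "r = d * s" using \<open>d dvd r\<close> by (simp add: s_def)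
    then have "s > 0" "d > 0" using \<open>r > 0\<close> by auto
    define Y where "Y = (\<lambda>q. q div f) ` F"
    have inj: "inj_on (\<lambda>q. q div f) F" using f(2) by (intro inj_onI) (metis dvd_div_mult_self)
    have "real (card Y) \<le> (C * real s powr \<epsilon>) * (D / real s + 1)"
    proof (rule card_le_residue_classes)
      show "real (card ((\<lambda>x. x mod s) ` Y)) \<le> C * real s powr \<epsilon>"
        using \<open>s > 0\<close> f(3,4) by (intro C) (auto simp: Y_def s_def)
      fix x y assume "x \<in> Y" "y \<in> Y"
      then obtain x' y' where xy: "x' \<in> F" "y' \<in> F" "x = x' div f" "y = y' div f"
        by (auto simp: Y_def)
      then have "real x' = real f * real x" "real y' = real f * real y"
        using f(2) by (metis dvd_mult_div_cancel of_nat_mult)+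
      then have "real f * \<bar>real x - real y\<bar> = \<bar>real x' - real y'\<bar>"
        by (simp add: abs_mult flip: right_diff_distrib)
      moreover have "1 * \<bar>real x - real y\<bar> \<le> real f * \<bar>real x - real y\<bar>"
        using f(1) by (intro mult_right_mono) auto
      ultimately show "\<bar>real x - real y\<bar> \<le> D" using diam[OF xy(1,2)] by (metis mult_1 order.trans)
    qed (use \<open>finite F\<close> \<open>s > 0\<close> \<open>D \<ge> 0\<close> in \<open>auto simp: Y_def\<close>)
    also have "\<dots> \<le> (C * real r powr \<epsilon>) * (D / real s + 1)"
    proof -
      have "s \<le> r" using \<open>r > 0\<close> rs by (intro dvd_imp_le) auto
      then show ?thesis
        using assms \<open>C > 0\<close> \<open>D \<ge> 0\<close> by (intro mult_right_mono mult_left_mono powr_mono2) auto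
    qed
    also have "D / real s = D * real d / real r" unfolding rs using \<open>d > 0\<close> by simp
    finally show ?thesis unfolding Y_def by (simp add: card_image[OF inj])
  qed
  show ?thesis
  proof (intro exI[of _ C] conjI allI impI)
    fix r d :: nat and F :: "nat set" and D :: real
    assume *: "r > 0" "d dvd r" "finite F" "D \<ge> 0"
      "\<forall>q\<in>F. q > 0 \<and> gcd (q ^ k) r = d" "\<forall>x\<in>F. \<forall>y\<in>F. [x ^ k = y ^ k] (mod r)"
      "\<forall>x\<in>F. \<forall>y\<in>F. \<bar>real x - real y\<bar> \<le> D"
    show "real (card F) \<le> C * real r powr \<epsilon> * (D * real d / real r + 1)"
      by (rule main[OF *(1-4)]) (use *(5-7) in blast)+
  qed (rule \<open>C > 0\<close>)
qed

text \<open>If \<open>x\<close> is within \<open>1 / (r * sqrt N)\<close> of \<open>h / r\<close>, then the fractions \<open>b / q ^ k\<close> close to \<open>x\<close> have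
  \<open>m = b * r - h * q ^ k\<close> small. Fixing \<open>m\<close> and \<open>d = gcd (q ^ k) r\<close> restricts \<open>q\<close> to a short interval
  and to few residue classes.\<close>

lemma block_count_fixed_approximation:
  fixes k N r :: nat and h :: int and x X \<epsilon> C1 C2 :: real
  assumes "k \<ge> 2" and "N \<ge> 1" and X: "X \<ge> 1" "X ^ k \<le> real N"
    and r: "r > 0" "real r \<le> sqrt (real N)" and cop: "coprime h (int r)"
    and approx: "\<bar>real r * x - of_int h\<bar> \<le> 2 / sqrt (real N)"
    and C1: "real (card {d. d dvd r}) \<le> C1"
    and C2: "\<And>d (F :: nat set) D. d dvd r \<Longrightarrow> finite F \<Longrightarrow> D \<ge> 0 \<Longrightarrow>
      (\<forall>q\<in>F. q > 0 \<and> gcd (q ^ k) r = d) \<Longrightarrow> (\<forall>x\<in>F. \<forall>y\<in>F. [x ^ k = y ^ k] (mod r)) \<Longrightarrow>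
      (\<forall>x\<in>F. \<forall>y\<in>F. \<bar>real x - real y\<bar> \<le> D) \<Longrightarrow> real (card F) \<le> C2 * (D * real d / real r + 1)"
    and "C2 \<ge> 0"
  defines "A \<equiv> {(q, b). X / 2 < real q \<and> real q \<le> X \<and> 1 \<le> b \<and> b \<le> q ^ k \<and> coprime b q \<and>
    \<bar>real b / real (q ^ k) - x\<bar> \<le> 1 / (2 * real N)}"
  shows "real (card A) \<le> 1 + C1 * C2 * (2 ^ (k + 1) + 8) * (X ^ k / sqrt (real N))"
proof -
  define z where "z = x - of_int h / real r"
  \<comment> \<open>The distance from \<open>x\<close> to \<open>h / r\<close>, but not taken below
    the length of the window: closer than that, the interval for \<open>q\<close> cannot be
    shortened any further.\<close>
  define \<delta> where "\<delta> = max \<bar>z\<bar> (1 / real N)"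
  have \<delta>: "\<delta> > 0" "\<bar>z\<bar> \<le> \<delta>" "1 / real N \<le> \<delta>"
    using \<open>N \<ge> 1\<close> by (auto simp: \<delta>_def less_max_iff_disj)
  have "k > 0" using \<open>k \<ge> 2\<close> by simp
  have sqN: "sqrt (real N) > 0" "sqrt (real N) * sqrt (real N) = real N" using \<open>N \<ge> 1\<close> by auto
  have r\<delta>: "real r * \<delta> \<le> 2 / sqrt (real N)"
  proof -
    have "real r * \<bar>z\<bar> = \<bar>real r * x - of_int h\<bar>"
    proof -
      have "real r * z = real r * x - of_int h" using r(1) by (simp add: z_def algebra_simps)
      then show ?thesis by (metis abs_mult abs_of_nat)
    qed
    then have "real r * \<bar>z\<bar> \<le> 2 / sqrt (real N)" using approx by simp
    moreover have "real r * (1 / real N) \<le> sqrt (real N) * (1 / real N)"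
      using r(2) by (intro mult_right_mono) auto
    moreover have "sqrt (real N) * (1 / real N) = 1 / sqrt (real N)"
      using sqN by (simp add: field_simps)
    moreover have "1 / sqrt (real N) \<le> 2 / sqrt (real N)" using sqN by (intro divide_right_mono) auto
    ultimately show ?thesis unfolding \<delta>_def by (auto simp: max_def)
  qed
  define V where "V = 2 * real r * \<delta> * X ^ k"
  \<comment> \<open>\<open>V\<close> bounds \<open>\<bar>m\<bar>\<close>, and \<open>D\<close>
    bounds the spread of \<open>q\<close> for a fixed \<open>m\<close>. If
    \<open>\<delta> = 1 / N\<close> the latter follows from the length of the block, otherwise from
    the equation for \<open>m\<close>. In \<open>V * D\<close> the factor \<open>\<delta>\<close>
    cancels.\<close>
  define D where "D = 2 ^ (k - 1) * X / (real N * \<delta>)"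
  have "V \<ge> 0" "D \<ge> 0" using \<delta> X by (auto simp: V_def D_def)
  define m where "m = (\<lambda>(q::nat, b::nat). int b * int r - h * int q ^ k)"
  have "A \<subseteq> (\<Union>q\<in>{..nat \<lfloor>X\<rfloor>}. {q} \<times> {..q ^ k})"
    unfolding A_def by (auto simp: le_nat_floor)
  then have "finite A" by (rule finite_subset) auto
  have Apos: "q > 0" "b > 0" if "(q, b) \<in> A" for q b
    using that X unfolding A_def by auto
  have dist: "\<bar>of_int (m (q, b)) - z * real r * real q ^ k\<bar> \<le> real r * X ^ k / (2 * real N)"
    if "(q, b) \<in> A" for q b
  proof -
    have "q > 0" using Apos[OF that] by simp
    have "of_int (m (q, b)) - z * real r * real q ^ k
        = real r * real q ^ k * (real b / real (q ^ k) - x)"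
      using \<open>q > 0\<close> r(1) unfolding m_def z_def by (simp add: field_simps)
    then have "\<bar>of_int (m (q, b)) - z * real r * real q ^ k\<bar>
        = real r * real q ^ k * \<bar>real b / real (q ^ k) - x\<bar>"
      by (simp add: abs_mult)
    also have "\<dots> \<le> real r * X ^ k * (1 / (2 * real N))"
      using that unfolding A_def by (intro mult_mono power_mono) auto
    finally show ?thesis by simp
  qed
  have m_le: "\<bar>of_int (m (q, b))\<bar> \<le> V" if "(q, b) \<in> A" for q b
  proof -
    have "real q ^ k \<le> X ^ k" using that by (intro power_mono) (auto simp: A_def)
    then have "\<bar>z * real r * real q ^ k\<bar> \<le> \<delta> * real r * X ^ k"
      using \<delta> X unfolding abs_mult by (intro mult_mono) auto
    moreover have "real r * X ^ k / (2 * real N) \<le> \<delta> * real r * X ^ k"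
    proof -
      have "real r * X ^ k / (2 * real N) = (1 / real N) * (real r * X ^ k) / 2" by simp
      also have "\<dots> \<le> \<delta> * (real r * X ^ k) / 2"
        using \<delta> X by (intro divide_right_mono mult_right_mono) auto
      also have "\<dots> \<le> \<delta> * real r * X ^ k" using \<delta> X by simp
      finally show ?thesis .
    qed
    moreover have "\<bar>u\<bar> \<le> 2 * c" if "\<bar>u - w\<bar> \<le> v" "\<bar>w\<bar> \<le> c" "v \<le> c" for u v w c :: real
      using that by linarith
    ultimately have "\<bar>of_int (m (q, b))\<bar> \<le> 2 * (\<delta> * real r * X ^ k)"
      using dist[OF that] by blast
    then show ?thesis by (simp add: V_def mult_ac)
  qed
  \<comment> \<open>Here \<open>b / q ^ k = h / r\<close> with both sides in lowest terms, so
    \<open>q\<close> and \<open>b\<close> are determined.\<close>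
  have zero: "card {p \<in> A. m p = 0} \<le> 1"
  proof -
    have "q ^ k = r \<and> int b = h" if "(q, b) \<in> A" "m (q, b) = 0" for q b
    proof -
      have eq: "int b * int r = h * int (q ^ k)" using that(2) by (simp add: m_def)
      have "coprime (int (q ^ k)) (int b)"
        using that(1) by (simp add: A_def coprime_commute)
      then have "int (q ^ k) dvd int r" using eq by (metis coprime_dvd_mult_right_iff dvd_triv_right)
      moreover have "int r dvd int (q ^ k)"
        using eq cop by (metis coprime_commute coprime_dvd_mult_right_iff dvd_triv_right)
      ultimately have "q ^ k = r" by (metis dvd_antisym of_nat_dvd_iff)
      then show ?thesis using eq r(1) by auto
    qed
    then have "p = p'" if "p \<in> {p \<in> A. m p = 0}" "p' \<in> {p \<in> A. m p = 0}" for p p'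
    proof -
      obtain q b q' b' where p: "p = (q, b)" "p' = (q', b')" by (cases p; cases p') auto
      then have "q ^ k = r" "int b = h" "q' ^ k = r" "int b' = h"
        using \<open>\<And>q b. (q, b) \<in> A \<Longrightarrow> m (q, b) = 0 \<Longrightarrow> q ^ k = r \<and> int b = h\<close> that by auto
      then have "q = q'" "b = b'" using \<open>k > 0\<close> power_eq_imp_eq_base[of q k q'] by auto
      then show ?thesis using p by simp
    qed
    then show ?thesis using \<open>finite A\<close> by (simp add: card_le_Suc0_iff_eq)
  qed
  define B where "B = (\<lambda>d. {p \<in> A. m p \<noteq> 0 \<and> gcd (fst p ^ k) r = d})"
  \<comment> \<open>There are at most \<open>2 * V / d\<close> values of \<open>m\<close>, all
    multiples of \<open>d\<close>, and \<open>D * d / r + 1\<close> is the count for each, up to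
    \<open>C2\<close>: the factor \<open>d\<close> cancels in the main term. What remains is
    \<open>V * D / r\<close>, controlled by \<open>X <= sqrt N\<close>, and
    \<open>V / d <= V\<close>, controlled by the Dirichlet bound on
    \<open>r * \<delta>\<close>.\<close>
  have B: "real (card (B d)) \<le> C2 * (2 ^ (k + 1) + 8) * (X ^ k / sqrt (real N))" if "d dvd r" for d
  proof -
    have "d > 0" using \<open>d dvd r\<close> r(1) by (auto intro: Nat.gr0I)
    let ?M = "{m::int. m \<noteq> 0 \<and> int d dvd m \<and> \<bar>of_int m\<bar> \<le> V}"
    have fib: "real (card {p \<in> B d. m p = t}) \<le> C2 * (D * real d / real r + 1)" for t
    proof -
      let ?F = "{p \<in> B d. m p = t}"
      have sub: "?F \<subseteq> A" by (auto simp: B_def)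
      have inj: "inj_on fst ?F"
      proof (rule inj_onI)
        fix p p' assume *: "p \<in> ?F" "p' \<in> ?F" "fst p = fst p'"
        obtain q b b' where p: "p = (q, b)" "p' = (q, b')" using *(3) by (cases p; cases p') auto
        then have "int b * int r = int b' * int r" using * by (auto simp: m_def)
        then show "p = p'" using r(1) p by simp
      qed
      have "real (card (fst ` ?F)) \<le> C2 * (D * real d / real r + 1)"
      proof (rule C2[OF \<open>d dvd r\<close> _ \<open>D \<ge> 0\<close>])
        show "finite (fst ` ?F)" using \<open>finite A\<close> sub by (intro finite_imageI) (rule finite_subset)
        show "\<forall>q\<in>fst ` ?F. q > 0 \<and> gcd (q ^ k) r = d"
          using Apos by (auto simp: B_def)
        show "\<forall>x\<in>fst ` ?F. \<forall>y\<in>fst ` ?F. [x ^ k = y ^ k] (mod r)"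
        proof (intro ballI)
          fix q q' assume "q \<in> fst ` ?F" "q' \<in> fst ` ?F"
          then obtain b b' where "m (q, b) = t" "m (q', b') = t" by force
          then have "h * int q ^ k - h * int q' ^ k = (int b - int b') * int r"
            by (simp add: m_def algebra_simps)
          then have "[h * int q ^ k = h * int q' ^ k] (mod int r)" by (simp add: cong_iff_dvd_diff)
          then have "[int q ^ k = int q' ^ k] (mod int r)"
            using cop by (simp add: cong_mult_lcancel)
          then show "[q ^ k = q' ^ k] (mod r)" by (simp add: cong_int_iff flip: of_nat_power)
        qed
        show "\<forall>x\<in>fst ` ?F. \<forall>y\<in>fst ` ?F. \<bar>real x - real y\<bar> \<le> D"
        proof (intro ballI)
          fix q q' assume "q \<in> fst ` ?F" "q' \<in> fst ` ?F"
          then obtain b b' where qb: "(q, b) \<in> A" "(q', b') \<in> A" "m (q, b) = t" "m (q', b') = t"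
            using sub by force
          have qX: "X / 2 \<le> real q" "real q \<le> X" "X / 2 \<le> real q'" "real q' \<le> X"
            using qb by (auto simp: A_def)
          have "real r * (\<bar>z\<bar> * \<bar>real q ^ k - real q' ^ k\<bar>)
              = \<bar>z * real r * real q ^ k - z * real r * real q' ^ k\<bar>"
          proof -
            have "z * real r * real q ^ k - z * real r * real q' ^ k = real r * (z * (real q ^ k - real q' ^ k))"
              by (simp add: algebra_simps)
            then show ?thesis by (simp only: abs_mult abs_of_nat)
          qed
          also have "\<dots> \<le> real r * X ^ k / (2 * real N) + real r * X ^ k / (2 * real N)"
            using dist[OF qb(1)] dist[OF qb(2)] qb(3,4) by linarith
          also have "\<dots> = real r * (X ^ k / real N)" by simp
          finally have "\<bar>z\<bar> * \<bar>real q ^ k - real q' ^ k\<bar> \<le> X ^ k / real N"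
            using r(1) by (subst (asm) mult_le_cancel_left_pos) auto
          moreover have "\<bar>z\<bar> * (\<bar>real q - real q'\<bar> * (X / 2) ^ (k - 1)) \<le> \<bar>z\<bar> * \<bar>real q ^ k - real q' ^ k\<bar>"
            using abs_diff_power_ge[of "X / 2" "real q" "real q'" k] qX X \<open>k > 0\<close>
            by (intro mult_left_mono) auto
          ultimately have "\<bar>z\<bar> * \<bar>real q - real q'\<bar> * (X / 2) ^ (k - 1) \<le> (2 ^ (k - 1) * X / real N) * (X / 2) ^ (k - 1)"
            using X \<open>k > 0\<close> by (simp add: power_divide mult.assoc power_eq_if[of X k])
          then have 1: "\<bar>z\<bar> * \<bar>real q - real q'\<bar> \<le> 2 ^ (k - 1) * X / real N"
            using X by (subst (asm) mult_le_cancel_right_pos) auto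
          have "\<bar>real q - real q'\<bar> \<le> 1 * X" using qX X by (auto simp: abs_le_iff)
          also have "\<dots> \<le> 2 ^ (k - 1) * X" using X by (intro mult_right_mono) auto
          finally have 2: "(1 / real N) * \<bar>real q - real q'\<bar> \<le> 2 ^ (k - 1) * X / real N"
            by (simp add: divide_right_mono)
          have "\<delta> * \<bar>real q - real q'\<bar> \<le> 2 ^ (k - 1) * X / real N"
            unfolding \<delta>_def max_def using 1 2 by (auto split: if_splits)
          then show "\<bar>real q - real q'\<bar> \<le> D"
            unfolding D_def using \<delta>(1) \<open>N \<ge> 1\<close> by (simp add: field_simps)
        qed
      qed
      then show ?thesis by (simp add: card_image[OF inj])
    qed
    have image: "m p \<in> ?M" if "p \<in> B d" for p
    proof -
      obtain q b where p: "p = (q, b)" by (cases p)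
      have "d dvd q ^ k" "d dvd r" using that unfolding B_def p by auto
      then have "int d dvd int q ^ k" "int d dvd int r" by (simp_all flip: of_nat_power)
      then have "int d dvd m p" unfolding m_def p by simp
      then show ?thesis using that m_le unfolding B_def p by auto
    qed
    have finM: "finite ?M" and cardM: "real (card ?M) \<le> 2 * V / real d"
      using card_nonzero_multiples_le[OF \<open>d > 0\<close> \<open>V \<ge> 0\<close>] by blast+
    have "card (\<Union>t\<in>?M. {p \<in> B d. m p = t}) \<le> (\<Sum>t\<in>?M. card {p \<in> B d. m p = t})"
      using finM by (rule card_UN_le)
    moreover have "(\<Union>t\<in>?M. {p \<in> B d. m p = t}) = B d" using image by blast
    ultimately have "real (card (B d)) \<le> real (\<Sum>t\<in>?M. card {p \<in> B d. m p = t})"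
      by (simp only: of_nat_le_iff)
    also have "\<dots> = (\<Sum>t\<in>?M. real (card {p \<in> B d. m p = t}))" by (rule of_nat_sum)
    also have "\<dots> \<le> real (card ?M) * (C2 * (D * real d / real r + 1))"
      by (rule sum_bounded_above[OF fib])
    also have "\<dots> \<le> 2 * V / real d * (C2 * (D * real d / real r + 1))"
      using cardM \<open>C2 \<ge> 0\<close> \<open>D \<ge> 0\<close> by (intro mult_right_mono) auto
    also have "\<dots> = C2 * (2 * (V * D / real r) + 2 * V / real d)"
      using \<open>d > 0\<close> r(1) by (simp add: field_simps)
    also have "\<dots> \<le> C2 * (2 * (2 ^ k * (X ^ k / sqrt (real N))) + 2 * (4 * (X ^ k / sqrt (real N))))"
    proof (intro mult_left_mono add_mono)
      have "V * D / real r = 2 * 2 ^ (k - 1) * (X * X ^ k / real N)"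
        using r(1) \<delta>(1) by (simp add: V_def D_def)
      also have "2 * 2 ^ (k - 1) = (2::real) ^ k" using \<open>k > 0\<close> by (simp add: power_eq_if)
      also have "X * X ^ k / real N \<le> X ^ k / sqrt (real N)"
      proof -
        \<comment> \<open>This is where \<open>k >= 2\<close> matters: together with
          \<open>X ^ k <= N\<close> it gives \<open>X <= sqrt N\<close>.\<close>
        have "X ^ 2 \<le> X ^ k" using X \<open>k \<ge> 2\<close> by (intro power_increasing) auto
        then have "X \<le> sqrt (real N)" using X by (intro real_le_rsqrt) linarith
        then have "X * X ^ k \<le> sqrt (real N) * X ^ k" using X by (intro mult_right_mono) auto
        then have "X * X ^ k / real N \<le> sqrt (real N) * X ^ k / (sqrt (real N) * sqrt (real N))"
          unfolding sqN(2) by (intro divide_right_mono) auto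
        then show ?thesis
          by (simp only: nonzero_mult_divide_mult_cancel_left[OF less_imp_neq[OF sqN(1), THEN not_sym]])
      qed
      finally show "V * D / real r \<le> 2 ^ k * (X ^ k / sqrt (real N))" by simp
      have "V / real d \<le> V" using \<open>d > 0\<close> \<open>V \<ge> 0\<close> by (simp add: field_simps mult_le_cancel_left1)
      also have "V = 2 * (real r * \<delta>) * X ^ k" by (simp add: V_def)
      also have "\<dots> \<le> 2 * (2 / sqrt (real N)) * X ^ k"
        using r\<delta> X by (intro mult_right_mono mult_left_mono) auto
      finally show "2 * V / real d \<le> 2 * (4 * (X ^ k / sqrt (real N)))" by simp
    qed (use \<open>C2 \<ge> 0\<close> in auto)
    also have "\<dots> = C2 * (2 ^ (k + 1) + 8) * (X ^ k / sqrt (real N))" by (simp add: algebra_simps)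
    finally show ?thesis .
  qed
  have finr: "finite {d. d dvd r}" using r(1) by simp
  have "{p \<in> A. m p = 0} \<union> (\<Union>d\<in>{d. d dvd r}. B d) = A" by (auto simp: B_def)
  then have "card A \<le> card {p \<in> A. m p = 0} + card (\<Union>d\<in>{d. d dvd r}. B d)"
    using card_Un_le[of "{p \<in> A. m p = 0}" "\<Union>d\<in>{d. d dvd r}. B d"] by (simp only:)
  also have "\<dots> \<le> 1 + (\<Sum>d\<in>{d. d dvd r}. card (B d))"
    using zero finr by (intro add_mono card_UN_le) auto
  finally have "real (card A) \<le> real (1 + (\<Sum>d\<in>{d. d dvd r}. card (B d)))"
    by (simp only: of_nat_le_iff)
  also have "\<dots> = 1 + (\<Sum>d\<in>{d. d dvd r}. real (card (B d)))" by simp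
  also have "(\<Sum>d\<in>{d. d dvd r}. real (card (B d)))
      \<le> real (card {d. d dvd r}) * (C2 * (2 ^ (k + 1) + 8) * (X ^ k / sqrt (real N)))"
    by (rule sum_bounded_above) (use B in auto)
  also have "\<dots> \<le> C1 * (C2 * (2 ^ (k + 1) + 8) * (X ^ k / sqrt (real N)))"
    using C1 \<open>C2 \<ge> 0\<close> X by (intro mult_right_mono) auto
  finally show ?thesis by (simp add: mult.assoc)
qed

section \<open>Sieve sums over ranges of moduli\<close>

text \<open>The range of \<open>q\<close> is half-open so that consecutive blocks are disjoint, and
  \<open>Y = 0\<close> gives all positive \<open>q\<close> up to \<open>X\<close>.\<close>

definition power_fractions :: "nat \<Rightarrow> real \<Rightarrow> real \<Rightarrow> (nat \<times> nat) set" where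
  "power_fractions k Y X =
    {(q, b). Y < real q \<and> real q \<le> X \<and> 1 \<le> b \<and> b \<le> q ^ k \<and> coprime b q}"

definition power_sieve_sum :: "nat \<Rightarrow> real \<Rightarrow> real \<Rightarrow> int \<Rightarrow> nat \<Rightarrow> (int \<Rightarrow> complex) \<Rightarrow> real" where
  "power_sieve_sum k Y X M N a = (\<Sum>(q, b)\<in>power_fractions k Y X.
    (cmod (\<Sum>n = M + 1..M + int N. a n * e (real b / real (q ^ k) * real_of_int n)))\<^sup>2)"

text \<open>The half-width is the one in the hypothesis of \<open>large_sieve\<close>, so a bound on
  the size of this set, uniform in \<open>x\<close>, serves as \<open>K\<close> there.\<close>

definition nearby_fractions :: "nat \<Rightarrow> real \<Rightarrow> real \<Rightarrow> nat \<Rightarrow> real \<Rightarrow> (nat \<times> nat) set" where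
  "nearby_fractions k Y X N x =
    {(q, b) \<in> power_fractions k Y X. \<bar>real b / real (q ^ k) - x\<bar> \<le> 1 / (2 * real N)}"

lemma power_fractions_eq_Sigma:
  "power_fractions k Y X = Sigma {q. Y < real q \<and> real q \<le> X} (\<lambda>q. {b. 1 \<le> b \<and> b \<le> q ^ k \<and> coprime b q})"
  by (auto simp: power_fractions_def)

lemma finite_nat_le_real: "finite {q::nat. P q \<and> real q \<le> X}"
proof (rule finite_subset)
  show "{q. P q \<and> real q \<le> X} \<subseteq> {..nat \<lfloor>X\<rfloor>}" by (auto simp: le_nat_floor)
qed simp

lemma finite_power_fractions: "finite (power_fractions k Y X)"
  unfolding power_fractions_eq_Sigma
proof (intro finite_SigmaI finite_nat_le_real)
  show "finite {b. 1 \<le> b \<and> b \<le> q ^ k \<and> coprime b q}" for q :: nat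
    by (rule finite_subset[of _ "{..q ^ k}"]) auto
qed

lemma power_sieve_sum_le:
  assumes "N \<ge> 1" and K: "\<And>x. real (card (nearby_fractions k Y X N x)) \<le> K"
  shows "power_sieve_sum k Y X M N a
    \<le> (6 + 12 * pi\<^sup>2) * K * real N * (\<Sum>n = M + 1..M + int N. (cmod (a n))\<^sup>2)"
proof -
  have "{p \<in> power_fractions k Y X. \<bar>real (snd p) / real (fst p ^ k) - x\<bar> \<le> 1 / (2 * real N)}
      = nearby_fractions k Y X N x" for x
    by (auto simp: nearby_fractions_def)
  moreover have "0 \<le> real (snd p) / real (fst p ^ k) \<and> real (snd p) / real (fst p ^ k) \<le> 1"
    if "p \<in> power_fractions k Y X" for p
    using that by (auto simp: power_fractions_def divide_le_eq_1 simp flip: of_nat_power)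
  ultimately show ?thesis
    using large_sieve[of "power_fractions k Y X" N "\<lambda>p. real (snd p) / real (fst p ^ k)" K a M]
      assms finite_power_fractions
    by (simp add: power_sieve_sum_def case_prod_beta)
qed

lemma power_sieve_sum_split:
  assumes "0 \<le> Y" "Y \<le> X"
  shows "power_sieve_sum k 0 X M N a = power_sieve_sum k 0 Y M N a + power_sieve_sum k Y X M N a"
proof -
  have "power_fractions k 0 X = power_fractions k 0 Y \<union> power_fractions k Y X"
    using assms by (auto simp: power_fractions_def)
  moreover have "power_fractions k 0 Y \<inter> power_fractions k Y X = {}"
    by (auto simp: power_fractions_def)
  ultimately show ?thesis
    unfolding power_sieve_sum_def by (simp add: sum.union_disjoint finite_power_fractions)
qed

lemma card_nearby_le_large_moduli:
  assumes "N \<ge> 1" "Q \<ge> 1" "real N \<le> Q ^ k"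
  shows "real (card (nearby_fractions k 0 Q N x)) \<le> 2 * Q ^ (k + 1) / real N"
proof -
  let ?q = "{1..nat \<lfloor>Q\<rfloor>}"
  let ?B = "\<lambda>q. {b. b \<le> q ^ k \<and> \<bar>real b / real (q ^ k) - x\<bar> \<le> 1 / (2 * real N)}"
  have finB: "finite (?B q)" for q by (rule finite_subset[of _ "{..q ^ k}"]) auto
  have cardB: "real (card (?B q)) \<le> 2 * Q ^ k / real N" if "q \<in> ?q" for q
  proof -
    have q: "q > 0" "real q \<le> Q" using that \<open>Q \<ge> 1\<close> by (auto simp: le_nat_iff le_floor_iff)
    have "real (card (?B q)) \<le> Q ^ k / real N + 1"
    proof (rule card_le_diameter[OF finB])
      fix b b' assume "b \<in> ?B q" "b' \<in> ?B q"
      then have "\<bar>real b / real (q ^ k) - real b' / real (q ^ k)\<bar> \<le> 1 / (2 * real N) + 1 / (2 * real N)"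
        by (simp only: mem_Collect_eq) linarith
      also have "\<dots> = 1 / real N" by simp
      also have "real b / real (q ^ k) - real b' / real (q ^ k) = (real b - real b') / real (q ^ k)"
        by (simp add: diff_divide_distrib)
      finally have "\<bar>real b - real b'\<bar> \<le> 1 / real N * real (q ^ k)"
        using q by (simp add: pos_divide_le_eq)
      also have "\<dots> \<le> 1 / real N * Q ^ k"
        using q by (intro mult_left_mono) (auto intro: power_mono)
      finally show "\<bar>real b - real b'\<bar> \<le> Q ^ k / real N" by simp
    qed (use \<open>Q \<ge> 1\<close> in auto)
    \<comment> \<open>The assumption \<open>N <= Q ^ k\<close> absorbs the \<open>+ 1\<close> of the
      interval count.\<close>
    also have "1 \<le> Q ^ k / real N" using assms by simp
    finally show ?thesis by simp
  qed
  have "nearby_fractions k 0 Q N x \<subseteq> Sigma ?q ?B"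
    by (auto simp: nearby_fractions_def power_fractions_def le_nat_floor)
  then have "card (nearby_fractions k 0 Q N x) \<le> card (Sigma ?q ?B)"
    using finB by (intro card_mono) auto
  also have "\<dots> = (\<Sum>q\<in>?q. card (?B q))" using finB by (intro card_SigmaI) auto
  finally have "real (card (nearby_fractions k 0 Q N x)) \<le> real (\<Sum>q\<in>?q. card (?B q))"
    by (simp only: of_nat_le_iff)
  also have "\<dots> = (\<Sum>q\<in>?q. real (card (?B q)))" by (rule of_nat_sum)
  also have "\<dots> \<le> real (card ?q) * (2 * Q ^ k / real N)"
    by (rule sum_bounded_above[OF cardB])
  also have "\<dots> \<le> Q * (2 * Q ^ k / real N)"
    using \<open>Q \<ge> 1\<close> by (intro mult_right_mono) auto
  finally show ?thesis by (simp add: mult_ac)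
qed

text \<open>Distinct reduced fractions with denominators at most \<open>Q ^ k\<close> differ by at
  least \<open>1 / Q ^ (2 * k)\<close>, which exceeds the window length
  \<open>1 / N\<close>.\<close>

lemma card_nearby_le_small_moduli:
  assumes "k > 0" "Q ^ (2 * k) < real N"
  shows "real (card (nearby_fractions k 0 Q N x)) \<le> 1"
proof -
  have "p = p'" if "p \<in> nearby_fractions k 0 Q N x" "p' \<in> nearby_fractions k 0 Q N x" for p p'
  proof -
    obtain q b q' b' where p: "p = (q, b)" "p' = (q', b')" by (cases p; cases p') auto
    have q: "q > 0" "q' > 0" "real q \<le> Q" "real q' \<le> Q" "coprime b (q ^ k)" "coprime b' (q' ^ k)"
      using that unfolding p nearby_fractions_def power_fractions_def by auto
    have "real N > 0" using assms(2) q by (smt (verit) of_nat_0_le_iff zero_le_power)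
    have le: "real (q ^ k) * real (q' ^ k) \<le> Q ^ (2 * k)"
      using q by (auto simp: mult_2 power_add intro!: mult_mono power_mono)
    have "\<bar>real b / real (q ^ k) - x\<bar> \<le> 1 / (2 * real N)" "\<bar>real b' / real (q' ^ k) - x\<bar> \<le> 1 / (2 * real N)"
      using that unfolding p nearby_fractions_def by auto
    then have "\<bar>real b / real (q ^ k) - real b' / real (q' ^ k)\<bar> \<le> 1 / (2 * real N) + 1 / (2 * real N)"
      by linarith
    also have "\<dots> = 1 / real N" by simp
    also have "real b / real (q ^ k) - real b' / real (q' ^ k)
        = of_int (int b * int q' ^ k - int b' * int q ^ k) / (real (q ^ k) * real (q' ^ k))"
      using q by (simp add: field_simps)
    finally have "\<bar>of_int (int b * int q' ^ k - int b' * int q ^ k)\<bar> \<le> 1 / real N * (real (q ^ k) * real (q' ^ k))"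
      using q by (simp add: abs_mult pos_divide_le_eq)
    also have "\<dots> \<le> 1 / real N * Q ^ (2 * k)" using le by (intro mult_left_mono) auto
    also have "\<dots> < 1" using assms(2) \<open>real N > 0\<close> by simp
    finally have "int b * int q' ^ k - int b' * int q ^ k = 0" by linarith
    then have "b * q' ^ k = b' * q ^ k" by (simp flip: of_nat_mult of_nat_power)
    then have "b = b'" "q' ^ k = q ^ k"
      using coprime_crossproduct_nat[of b "q ^ k" b' "q' ^ k"] q by auto
    then show ?thesis using power_eq_imp_eq_base[of q' k q] \<open>k > 0\<close> p by auto
  qed
  moreover have "finite (nearby_fractions k 0 Q N x)"
    by (rule finite_subset[OF _ finite_power_fractions]) (auto simp: nearby_fractions_def)
  ultimately have "card (nearby_fractions k 0 Q N x) \<le> 1" by (simp add: card_le_Suc0_iff_eq)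
  then show ?thesis by simp
qed

lemma card_nearby_block_bound:
  fixes k :: nat and \<epsilon> :: real
  assumes "k \<ge> 2" "\<epsilon> > 0"
  shows "\<exists>C>0. \<forall>N X x. N \<ge> 1 \<longrightarrow> X \<ge> 1 \<longrightarrow> X ^ k \<le> real N \<longrightarrow> real N \<le> X ^ (2 * k) \<longrightarrow>
    real (card (nearby_fractions k (X / 2) X N x)) \<le> C * real N powr \<epsilon> * (X ^ k / sqrt (real N))"
proof -
  have "k > 0" using \<open>k \<ge> 2\<close> by simp
  obtain C1 where "C1 > 0" and C1: "\<forall>n>0. real (card {d::nat. d dvd n}) \<le> C1 * real n powr \<epsilon>"
    using card_divisors_bound[OF \<open>\<epsilon> > 0\<close>] by blast
  obtain C2 where "C2 > 0" and C2: "\<forall>r d (F :: nat set) D. r > 0 \<longrightarrow> d dvd r \<longrightarrow> finite F \<longrightarrow> D \<ge> 0 \<longrightarrow>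
    (\<forall>q\<in>F. q > 0 \<and> gcd (q ^ k) r = d) \<longrightarrow> (\<forall>x\<in>F. \<forall>y\<in>F. [x ^ k = y ^ k] (mod r)) \<longrightarrow>
    (\<forall>x\<in>F. \<forall>y\<in>F. \<bar>real x - real y\<bar> \<le> D) \<longrightarrow>
    real (card F) \<le> C2 * real r powr \<epsilon> * (D * real d / real r + 1)"
    using card_congruent_powers_bound[OF \<open>k > 0\<close> \<open>\<epsilon> > 0\<close>] by blast
  define c where "c = C1 * C2 * (2 ^ (k + 1) + 8)"
  have "c > 0" using \<open>C1 > 0\<close> \<open>C2 > 0\<close> by (simp add: c_def add_pos_pos)
  show ?thesis
  proof (intro exI[of _ "1 + c"] conjI allI impI)
    fix N :: nat and X x :: real
    assume N: "N \<ge> 1" and X: "X \<ge> 1" "X ^ k \<le> real N" "real N \<le> X ^ (2 * k)"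
    \<comment> \<open>Dirichlet's theorem takes an integer bound for the denominator; rounding
      \<open>sqrt N\<close> down costs at most a factor 2, hence \<open>2 / sqrt N\<close> in the
      approximation.\<close>
    define s where "s = nat \<lfloor>sqrt (real N)\<rfloor>"
    have s: "s > 0" "real s \<le> sqrt (real N)" "sqrt (real N) \<le> 2 * real s"
    proof -
      have "sqrt (real N) \<ge> 1" using N by simp
      then have "\<lfloor>sqrt (real N)\<rfloor> \<ge> 1" by (simp add: le_floor_iff)
      then have "real s = of_int \<lfloor>sqrt (real N)\<rfloor>" unfolding s_def by simp
      with \<open>\<lfloor>sqrt (real N)\<rfloor> \<ge> 1\<close> show "s > 0" "real s \<le> sqrt (real N)" "sqrt (real N) \<le> 2 * real s"
        by linarith+
    qed
    obtain h r' where r': "coprime h r'" "0 < r'" "r' \<le> int s" "\<bar>of_int r' * x - of_int h\<bar> < 1 / real s"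
      using Dirichlet_approx_coprime[OF s(1), of x] by blast
    define r where "r = nat r'"
    have r: "r' = int r" "r > 0" "r \<le> s" using r' by (auto simp: r_def)
    have rN: "real r \<le> sqrt (real N)" using r(3) s(2) by linarith
    have "1 / real s \<le> 2 / sqrt (real N)" using s N by (simp add: field_simps)
    then have approx: "\<bar>real r * x - of_int h\<bar> \<le> 2 / sqrt (real N)"
      using r'(4) unfolding r(1) by simp
    have "real (card {(q, b). X / 2 < real q \<and> real q \<le> X \<and> 1 \<le> b \<and> b \<le> q ^ k \<and> coprime b q \<and>
        \<bar>real b / real (q ^ k) - x\<bar> \<le> 1 / (2 * real N)})
      \<le> 1 + (C1 * real r powr \<epsilon>) * (C2 * real r powr \<epsilon>) * (2 ^ (k + 1) + 8) * (X ^ k / sqrt (real N))"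
    proof (rule block_count_fixed_approximation[OF \<open>k \<ge> 2\<close> N X(1,2) r(2) rN _ approx])
      show "coprime h (int r)" using r'(1) r(1) by simp
      show "real (card {d. d dvd r}) \<le> C1 * real r powr \<epsilon>" using C1 r(2) by blast
      show "C2 * real r powr \<epsilon> \<ge> 0" using \<open>C2 > 0\<close> by simp
      show "real (card F) \<le> C2 * real r powr \<epsilon> * (D * real d / real r + 1)"
        if "d dvd r" "finite F" "D \<ge> 0" "\<forall>q\<in>F. q > 0 \<and> gcd (q ^ k) r = d"
          "\<forall>x\<in>F. \<forall>y\<in>F. [x ^ k = y ^ k] (mod r)" "\<forall>x\<in>F. \<forall>y\<in>F. \<bar>real x - real y\<bar> \<le> D"
        for d :: nat and F :: "nat set" and D
        using C2[rule_format, OF r(2) that(1,2,3)] that(4-6) by blast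
    qed
    also have "{(q, b). X / 2 < real q \<and> real q \<le> X \<and> 1 \<le> b \<and> b \<le> q ^ k \<and> coprime b q \<and>
        \<bar>real b / real (q ^ k) - x\<bar> \<le> 1 / (2 * real N)} = nearby_fractions k (X / 2) X N x"
      by (auto simp: nearby_fractions_def power_fractions_def)
    also have "(C1 * real r powr \<epsilon>) * (C2 * real r powr \<epsilon>) * (2 ^ (k + 1) + 8)
        = c * (real r powr \<epsilon> * real r powr \<epsilon>)"
      by (simp only: c_def mult_ac)
    also have "1 + c * (real r powr \<epsilon> * real r powr \<epsilon>) * (X ^ k / sqrt (real N))
        \<le> real N powr \<epsilon> * (X ^ k / sqrt (real N)) + c * real N powr \<epsilon> * (X ^ k / sqrt (real N))"
    proof (rule add_mono)
      \<comment> \<open>The lower bound on \<open>X\<close> makes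
        \<open>X ^ k / sqrt N >= 1\<close>, so that the single fraction with \<open>m = 0\<close> is
        absorbed.\<close>
      have "real N \<le> (X ^ k) ^ 2" using X(3) by (simp add: mult.commute flip: power_mult)
      then have "sqrt (real N) \<le> X ^ k" using X by (intro real_le_lsqrt) auto
      then have "1 \<le> X ^ k / sqrt (real N)" using N by simp
      moreover have "1 \<le> real N powr \<epsilon>" using N \<open>\<epsilon> > 0\<close> by (intro ge_one_powr_ge_zero) auto
      ultimately show "1 \<le> real N powr \<epsilon> * (X ^ k / sqrt (real N))"
        using mult_mono[of 1 "real N powr \<epsilon>" 1 "X ^ k / sqrt (real N)"] by simp
      \<comment> \<open>One factor comes from the divisors \<open>d\<close> of \<open>r\<close>, the
        other from the roots of the congruence; as \<open>r <= sqrt N\<close>, together they cost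
        only \<open>N powr \<epsilon>\<close>.\<close>
      have "real r powr \<epsilon> * real r powr \<epsilon> = (real r * real r) powr \<epsilon>" by (simp add: powr_mult)
      also have "\<dots> \<le> real N powr \<epsilon>"
      proof (rule powr_mono2)
        have "real r * real r \<le> sqrt (real N) * sqrt (real N)" using rN by (intro mult_mono) auto
        then show "real r * real r \<le> real N" by simp
      qed (use \<open>\<epsilon> > 0\<close> in auto)
      finally show "c * (real r powr \<epsilon> * real r powr \<epsilon>) * (X ^ k / sqrt (real N))
          \<le> c * real N powr \<epsilon> * (X ^ k / sqrt (real N))"
        using \<open>c > 0\<close> X by (intro mult_right_mono mult_left_mono) auto
    qed
    finally show "real (card (nearby_fractions k (X / 2) X N x))
        \<le> (1 + c) * real N powr \<epsilon> * (X ^ k / sqrt (real N))"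
      by (simp add: algebra_simps)
  qed (use \<open>c > 0\<close> in simp)
qed

section \<open>Summation over dyadic blocks\<close>

text \<open>Halving \<open>Q\<close> at least halves \<open>Q ^ k\<close>, so the block costs
  decrease geometrically. The halving stops once \<open>Q ^ (2 * k) < N\<close>; the term
  \<open>N\<close> is paid there, once and not for every block.\<close>

lemma power_sieve_sum_bound_small_moduli:
  fixes k :: nat and \<epsilon> :: real
  assumes "k \<ge> 2" "\<epsilon> > 0"
  shows "\<exists>C>0. \<forall>M N Q a. N \<ge> 1 \<longrightarrow> Q \<ge> 0 \<longrightarrow> Q ^ k \<le> real N \<longrightarrow>
    power_sieve_sum k 0 Q M N a
      \<le> C * (real N + real N powr (1 / 2 + \<epsilon>) * Q ^ k) * (\<Sum>n = M + 1..M + int N. (cmod (a n))\<^sup>2)"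
proof -
  have "k > 0" using \<open>k \<ge> 2\<close> by simp
  obtain C where "C > 0" and C: "\<And>N X x. N \<ge> 1 \<Longrightarrow> X \<ge> 1 \<Longrightarrow> X ^ k \<le> real N \<Longrightarrow> real N \<le> X ^ (2 * k) \<Longrightarrow>
      real (card (nearby_fractions k (X / 2) X N x)) \<le> C * real N powr \<epsilon> * (X ^ k / sqrt (real N))"
    using card_nearby_block_bound[OF assms] by metis
  define c where "c = 6 + 12 * pi\<^sup>2"
  have "c > 0" by (simp add: c_def add_pos_nonneg)
  \<comment> \<open>The summand \<open>c\<close> covers the range where the fractions are well
    spaced; the factor 2 lets one block use only half of the term with \<open>Q ^ k\<close>, leaving
    the other half to the induction hypothesis.\<close>
  define C' where "C' = c + 2 * (c * C)"
  have "c * C > 0" using \<open>c > 0\<close> \<open>C > 0\<close> by simp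
  then have C': "C' > 0" "c \<le> C'" "c * C \<le> C' / 2"
    using \<open>c > 0\<close> unfolding C'_def by (linarith, linarith, simp add: add_divide_distrib)
  \<comment> \<open>The induction variable \<open>n\<close> bounds the number of halvings; for
    \<open>n = 0\<close> we have \<open>Q < 1\<close> and there are no fractions.\<close>
  have bound: "power_sieve_sum k 0 Q M N a \<le> C' * (real N + real N powr (1 / 2 + \<epsilon>) * Q ^ k) * Z"
    if "N \<ge> 1" and Z: "Z = (\<Sum>n = M + 1..M + int N. (cmod (a n))\<^sup>2)" and "Q \<ge> 0" "Q ^ k \<le> real N" "Q < 2 ^ n"
    for M N Q a Z n
    using that(3-5)
  proof (induction n arbitrary: Q)
    case (0 Q)
    then have "power_fractions k 0 Q = {}" by (auto simp: power_fractions_def)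
    moreover have "Z \<ge> 0" unfolding Z by (intro sum_nonneg) auto
    ultimately show ?case using 0 C' by (simp add: power_sieve_sum_def)
  next
    case (Suc n Q)
    have "Z \<ge> 0" unfolding Z by (intro sum_nonneg) auto
    define R where "R = real N powr (1 / 2 + \<epsilon>) * Q ^ k"
    have "R \<ge> 0" using Suc.prems by (simp add: R_def)
    show ?case
    proof (cases "Q ^ (2 * k) < real N")
      case True
      have "power_sieve_sum k 0 Q M N a \<le> c * 1 * real N * Z"
        unfolding c_def Z
        by (rule power_sieve_sum_le[OF \<open>N \<ge> 1\<close>]) (rule card_nearby_le_small_moduli[OF \<open>k > 0\<close> True])
      also have "\<dots> \<le> C' * (real N + R) * Z"
        using C' \<open>R \<ge> 0\<close> \<open>Z \<ge> 0\<close> by (auto intro!: mult_right_mono mult_mono)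
      finally show ?thesis unfolding R_def .
    next
      case False
      have "Q \<ge> 1"
      proof (rule ccontr)
        assume "\<not> Q \<ge> 1"
        then have "Q ^ (2 * k) < 1" using Suc.prems \<open>k > 0\<close> by (intro power_less_one_iff[THEN iffD2]) auto
        then show False using False \<open>N \<ge> 1\<close> by simp
      qed
      have half: "(Q / 2) ^ k \<le> Q ^ k / 2"
      proof -
        have "(2::real) ^ 1 \<le> 2 ^ k" using \<open>k > 0\<close> by (intro power_increasing) auto
        then have "Q ^ k / 2 ^ k \<le> Q ^ k / 2" using \<open>Q \<ge> 1\<close> by (intro divide_left_mono) auto
        then show ?thesis by (simp add: power_divide)
      qed
      have "(Q / 2) ^ k \<le> real N" using half Suc.prems(2) \<open>Q \<ge> 1\<close> by (smt (verit) field_sum_of_halves zero_le_power)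
      then have "power_sieve_sum k 0 (Q / 2) M N a
          \<le> C' * (real N + real N powr (1 / 2 + \<epsilon>) * (Q / 2) ^ k) * Z"
        using Suc.prems by (intro Suc.IH) auto
      also have "\<dots> \<le> C' * (real N + real N powr (1 / 2 + \<epsilon>) * (Q ^ k / 2)) * Z"
        using half C' \<open>Z \<ge> 0\<close> by (intro mult_right_mono mult_left_mono add_left_mono) auto
      finally have 1: "power_sieve_sum k 0 (Q / 2) M N a \<le> C' * (real N + R / 2) * Z"
        by (simp add: R_def)
      have "power_sieve_sum k (Q / 2) Q M N a
          \<le> c * (C * real N powr \<epsilon> * (Q ^ k / sqrt (real N))) * real N * Z"
        unfolding c_def Z
        by (rule power_sieve_sum_le[OF \<open>N \<ge> 1\<close>])
          (rule C[OF \<open>N \<ge> 1\<close> \<open>Q \<ge> 1\<close> Suc.prems(2)], use False in simp)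
      also have "\<dots> = c * C * (real N powr \<epsilon> * (real N / sqrt (real N)) * Q ^ k) * Z" by simp
      also have "real N powr \<epsilon> * (real N / sqrt (real N)) = real N powr (1 / 2 + \<epsilon>)"
        using \<open>N \<ge> 1\<close> by (simp add: real_div_sqrt powr_add powr_half_sqrt)
      also have "c * C * (real N powr (1 / 2 + \<epsilon>) * Q ^ k) * Z \<le> C' / 2 * R * Z"
        unfolding R_def[symmetric] using C' \<open>R \<ge> 0\<close> \<open>Z \<ge> 0\<close> by (intro mult_right_mono) auto
      finally have 2: "power_sieve_sum k (Q / 2) Q M N a \<le> C' / 2 * R * Z" .
      have "power_sieve_sum k 0 Q M N a = power_sieve_sum k 0 (Q / 2) M N a + power_sieve_sum k (Q / 2) Q M N a"
        using \<open>Q \<ge> 1\<close> by (intro power_sieve_sum_split) auto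
      also have "\<dots> \<le> C' * (real N + R / 2) * Z + C' / 2 * R * Z" using 1 2 by (rule add_mono)
      also have "\<dots> = C' * (real N + R) * Z" by (simp add: algebra_simps)
      finally show ?thesis unfolding R_def .
    qed
  qed
  show ?thesis
  proof (intro exI[of _ C'] conjI allI impI)
    fix M :: int and N :: nat and Q :: real and a :: "int \<Rightarrow> complex"
    assume *: "N \<ge> 1" "Q \<ge> 0" "Q ^ k \<le> real N"
    obtain n where "Q < 2 ^ n" using real_arch_pow[of 2 Q] by auto
    then show "power_sieve_sum k 0 Q M N a
      \<le> C' * (real N + real N powr (1 / 2 + \<epsilon>) * Q ^ k) * (\<Sum>n = M + 1..M + int N. (cmod (a n))\<^sup>2)"
      by (rule bound[OF *(1) refl *(2,3)])
  qed (rule C'(1))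
qed

lemma power_sieve_sum_bound:
  fixes k :: nat and \<epsilon> :: real
  assumes "k \<ge> 2" "\<epsilon> > 0"
  shows "\<exists>C>0. \<forall>M N Q a. N \<ge> 1 \<longrightarrow> Q \<ge> 1 \<longrightarrow> power_sieve_sum k 0 Q M N a
      \<le> C * (Q ^ (k + 1) + real N + real N powr (1 / 2 + \<epsilon>) * Q ^ k) * (\<Sum>n = M + 1..M + int N. (cmod (a n))\<^sup>2)"
proof -
  obtain C where "C > 0" and C: "\<And>M N Q a. N \<ge> 1 \<Longrightarrow> Q \<ge> 0 \<Longrightarrow> Q ^ k \<le> real N \<Longrightarrow>
      power_sieve_sum k 0 Q M N a
        \<le> C * (real N + real N powr (1 / 2 + \<epsilon>) * Q ^ k) * (\<Sum>n = M + 1..M + int N. (cmod (a n))\<^sup>2)"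
    using power_sieve_sum_bound_small_moduli[OF assms] by metis
  define c where "c = 6 + 12 * pi\<^sup>2"
  have "c > 0" by (simp add: c_def add_pos_nonneg)
  show ?thesis
  proof (intro exI[of _ "2 * c + C"] conjI allI impI)
    fix M :: int and N :: nat and Q :: real and a :: "int \<Rightarrow> complex"
    assume *: "N \<ge> 1" "Q \<ge> 1"
    define Z where "Z = (\<Sum>n = M + 1..M + int N. (cmod (a n))\<^sup>2)"
    have "Z \<ge> 0" unfolding Z_def by (intro sum_nonneg) auto
    define T where "T = real N + real N powr (1 / 2 + \<epsilon>) * Q ^ k"
    have "T \<ge> 0" "Q ^ (k + 1) \<ge> 0" using * by (auto simp: T_def)
    have "power_sieve_sum k 0 Q M N a \<le> (2 * c + C) * (Q ^ (k + 1) + T) * Z"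
    proof (cases "real N \<le> Q ^ k")
      case True
      have "power_sieve_sum k 0 Q M N a \<le> c * (2 * Q ^ (k + 1) / real N) * real N * Z"
        unfolding c_def Z_def
        by (rule power_sieve_sum_le[OF *(1)]) (rule card_nearby_le_large_moduli[OF * True])
      also have "\<dots> = 2 * c * Q ^ (k + 1) * Z" using *(1) by simp
      also have "\<dots> \<le> (2 * c + C) * (Q ^ (k + 1) + T) * Z"
        using \<open>c > 0\<close> \<open>C > 0\<close> \<open>Z \<ge> 0\<close> \<open>T \<ge> 0\<close> \<open>Q ^ (k + 1) \<ge> 0\<close>
        by (intro mult_right_mono mult_mono) auto
      finally show ?thesis .
    next
      case False
      have "power_sieve_sum k 0 Q M N a \<le> C * T * Z"
        unfolding T_def Z_def using * False by (intro C) auto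
      also have "\<dots> \<le> (2 * c + C) * (Q ^ (k + 1) + T) * Z"
        using \<open>c > 0\<close> \<open>C > 0\<close> \<open>Z \<ge> 0\<close> \<open>T \<ge> 0\<close> \<open>Q ^ (k + 1) \<ge> 0\<close>
        by (intro mult_right_mono mult_mono) auto
      finally show ?thesis .
    qed
    then show "power_sieve_sum k 0 Q M N a
      \<le> (2 * c + C) * (Q ^ (k + 1) + real N + real N powr (1 / 2 + \<epsilon>) * Q ^ k) * (\<Sum>n = M + 1..M + int N. (cmod (a n))\<^sup>2)"
      unfolding T_def Z_def by (simp only: add.assoc)
  qed (use \<open>c > 0\<close> \<open>C > 0\<close> in simp)
qed

theorem theorem1:
  fixes k :: nat and \<epsilon> :: real
  assumes "k \<ge> 2" and "\<epsilon> > 0"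
  shows "\<exists>C>0. \<forall>(M::int) (N::nat) (Q::real) (a::int \<Rightarrow> complex).
    N \<ge> 1 \<longrightarrow> Q \<ge> 1 \<longrightarrow>
    (\<Sum>q::nat | 1 \<le> q \<and> real q \<le> Q. \<Sum>b::nat | 1 \<le> b \<and> b \<le> q ^ k \<and> coprime b q.
        (cmod (\<Sum>n = M + 1..M + int N. a n * e (real b / real (q ^ k) * real_of_int n)))\<^sup>2)
    \<le> C * (ln (ln (10 * real N * Q))) ^ (k + 1)
        * (Q ^ (k + 1) + real N + real N powr (1 / 2 + \<epsilon>) * Q ^ k)
        * (\<Sum>n = M + 1..M + int N. (cmod (a n))\<^sup>2)"
proof -
  obtain C where "C > 0" and C: "\<And>M N Q a. N \<ge> 1 \<Longrightarrow> Q \<ge> 1 \<Longrightarrow> power_sieve_sum k 0 Q M N a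
      \<le> C * (Q ^ (k + 1) + real N + real N powr (1 / 2 + \<epsilon>) * Q ^ k) * (\<Sum>n = M + 1..M + int N. (cmod (a n))\<^sup>2)"
    using power_sieve_sum_bound[OF assms] by metis
  \<comment> \<open>Since \<open>N * Q >= 1\<close> and \<open>10 > exp 1\<close>, the iterated
    logarithm is at least \<open>L > 0\<close>, and dividing the constant by
    \<open>L ^ (k + 1)\<close> inserts the required power of it.\<close>
  define L where "L = ln (ln (10 :: real))"
  have ln10: "ln (10 :: real) > 1"
  proof -
    have "exp 1 < (10 :: real)" using exp_le by linarith
    then have "ln (exp 1) < ln (10 :: real)" by (subst ln_less_cancel_iff) auto
    then show ?thesis by simp
  qed
  then have "L > 0" unfolding L_def by simp
  show ?thesis
  proof (intro exI[of _ "C / L ^ (k + 1)"] conjI allI impI)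
    fix M :: int and N :: nat and Q :: real and a :: "int \<Rightarrow> complex"
    assume *: "N \<ge> 1" "Q \<ge> 1"
    define Z where "Z = (\<Sum>n = M + 1..M + int N. (cmod (a n))\<^sup>2)"
    define T where "T = Q ^ (k + 1) + real N + real N powr (1 / 2 + \<epsilon>) * Q ^ k"
    have "Z \<ge> 0" unfolding Z_def by (intro sum_nonneg) auto
    have "T \<ge> 0" using * by (simp add: T_def)
    define LL where "LL = ln (ln (10 * real N * Q))"
    have "L \<le> LL"
    proof -
      have "1 * 1 \<le> real N * Q" using * by (intro mult_mono) auto
      then have "10 \<le> 10 * real N * Q" by simp
      then have "ln 10 \<le> ln (10 * real N * Q)" by (subst ln_le_cancel_iff) linarith+
      then show ?thesis unfolding L_def LL_def using ln10 by (subst ln_le_cancel_iff) auto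
    qed
    then have "L ^ (k + 1) \<le> LL ^ (k + 1)" using \<open>L > 0\<close> by (intro power_mono) auto
    then have LL: "C \<le> C / L ^ (k + 1) * LL ^ (k + 1)"
      using \<open>C > 0\<close> \<open>L > 0\<close> by (simp add: pos_le_divide_eq del: power_Suc)
    have "(\<Sum>q::nat | 1 \<le> q \<and> real q \<le> Q. \<Sum>b::nat | 1 \<le> b \<and> b \<le> q ^ k \<and> coprime b q.
        (cmod (\<Sum>n = M + 1..M + int N. a n * e (real b / real (q ^ k) * real_of_int n)))\<^sup>2)
      = power_sieve_sum k 0 Q M N a"
    proof -
      have fin: "finite {b. 1 \<le> b \<and> b \<le> q ^ k \<and> coprime b q}" for q :: nat
        by (rule finite_subset[of _ "{..q ^ k}"]) auto
      have "power_fractions k 0 Q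
          = Sigma {q. 1 \<le> q \<and> real q \<le> Q} (\<lambda>q. {b. 1 \<le> b \<and> b \<le> q ^ k \<and> coprime b q})"
        by (auto simp: power_fractions_def)
      then show ?thesis
        unfolding power_sieve_sum_def using fin finite_nat_le_real by (subst sum.Sigma) auto
    qed
    also have "\<dots> \<le> C * T * Z" unfolding T_def Z_def using * by (rule C)
    also have "\<dots> \<le> C / L ^ (k + 1) * LL ^ (k + 1) * T * Z"
      using LL \<open>T \<ge> 0\<close> \<open>Z \<ge> 0\<close> by (intro mult_right_mono)
    finally show "(\<Sum>q::nat | 1 \<le> q \<and> real q \<le> Q. \<Sum>b::nat | 1 \<le> b \<and> b \<le> q ^ k \<and> coprime b q.
        (cmod (\<Sum>n = M + 1..M + int N. a n * e (real b / real (q ^ k) * real_of_int n)))\<^sup>2)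
      \<le> C / L ^ (k + 1) * (ln (ln (10 * real N * Q))) ^ (k + 1)
        * (Q ^ (k + 1) + real N + real N powr (1 / 2 + \<epsilon>) * Q ^ k)
        * (\<Sum>n = M + 1..M + int N. (cmod (a n))\<^sup>2)"
      unfolding T_def Z_def LL_def .
  qed (use \<open>C > 0\<close> \<open>L > 0\<close> in simp)
qed

end
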